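(* Consider the hybrid human/AI system described in the context, with parameters $(\lambda,Q,\mu,m)$, safety tolerance $\epsilon$, and long-run average required capacity $\Lambda_{\mathrm{req}}=\sum_{\theta\in\Theta}\pi_\theta\lambda_{\min}(\theta)$. (i) (Stable region) If $\Lambda_{\mathrm{req}}<m\mu$, there exists a stationary Markovian policy that is $\epsilon$-safe almost surely and maintains a finite expected queue length, $\mathbb{E}[q]<\infty$, where $q$ is the steady-state queue length under the policy. (ii) (Unstable region) If $\Lambda_{\mathrm{req}}>m\mu$, then for any policy $u$ at least one of the following occurs: - the system is unstable: $\lim_{t\to\infty}\mathbb{P}(q(t)>N)=1$ for every $N$; - the policy violates the $\epsilon$-safety constraint on a set of states of positive measure, i.e. the set $\{(q,\theta,s): s>\bar T(\theta),\ u(q,\theta,s)=0\}$ has positive measure with respect to the product of counting measure on $\mathbb{N}_0\times\Theta$ and the law of the risk score on $[0,1]$.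
   Context: Model. Tasks arrive according to a Poisson process of rate $\lambda>0$. Each task has a risk score in $[0,1]$, observed on arrival; the scores are i.i.d. copies of a random variable $S$ with a distribution function $F_S$ on $[0,1]$ having a continuous density that is strictly positive on $(0,1)$. An exogenous reliability process $\theta(t)$ is an irreducible, ergodic continuous-time Markov chain on $\Theta=\{1,\dots,K\}$ with generator $Q$ and unique stationary distribution $(\pi_\theta)_{\theta\in\Theta}$. Arrivals, scores, service times and $\theta(t)$ are independent. Policies. A (stationary Markovian) policy is a measurable function $u:\mathbb{N}_0\times\Theta\times[0,1]\to\{0,1\}$: a task with score $s$ arriving when the queue length is $q$ and the regime is $\theta$ is automated if $u(q,\theta,s)=0$ (queue unchanged) and escalated if $u(q,\theta,s)=1$ (queue length increases by $1$). Escalated tasks are served in a queue with infinite buffer and $m\geq 1$ parallel servers with independent exponential service times of rate $\mu>0$ each, so the total service rate with $n$ tasks in system is $\min(n,m)\mu$; $q(t)$ is the number of tasks in system at time $t$. A threshold policy with thresholds $T(q,\theta)$ is $u(q,\theta,s)=\mathbf{1}\{s\ge T(q,\theta)\}$. Cost of automation. $c_{\mathrm{auto}}:[0,1]\times\Theta\to\mathbb{R}_+$ satisfies: for each fixed $\theta$, $c_{\mathrm{auto}}(\cdot,\theta)$ is strictly increasing, continuous and convex; for each fixed $s$, $c_{\mathrm{auto}}(s,\theta)$ is non-decreasing in $\theta$; and for $s'>s$, $\theta'>\theta$, $c_{\mathrm{auto}}(s',\theta')-c_{\mathrm{auto}}(s,\theta')\ge c_{\mathrm{auto}}(s',\theta)-c_{\mathrm{auto}}(s,\theta)$.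 Safety. Let $\epsilon\ge 0$ be a tolerance. The maximum permissible threshold in regime $\theta$ is $$\bar T(\theta)=\sup\{\tau\in[0,1]:\mathbb{E}[\mathbf{1}\{S<\tau\}\,c_{\mathrm{auto}}(S,\theta)]\le\epsilon\}.$$ A policy is $\epsilon$-safe if it never automates a task with score $s>\bar T(\theta)$ in regime $\theta$ (for a threshold policy: $T(q,\theta)\le\bar T(\theta)$ for all $q$ and $\theta$). The minimum arrival rate to the human queue in regime $\theta$ under an $\epsilon$-safe policy is $\lambda_{\min}(\theta)=\lambda\,\mathbb{P}(S\ge\bar T(\theta))$. *)

theory Defs
  imports "HOL-Probability.Probability"
begin

section \<open>Continuous-time Markov chains on a countable state space\<close>

definition transition_semigroup ::
    "('a \<Rightarrow> 'a \<Rightarrow> real) \<Rightarrow> (real \<Rightarrow> 'a \<Rightarrow> 'a pmf) \<Rightarrow> bool" where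
  "transition_semigroup G P \<longleftrightarrow>
     (\<forall>x. P 0 x = return_pmf x) \<and>
     (\<forall>s\<ge>0. \<forall>t\<ge>0. \<forall>x. P (s + t) x = bind_pmf (P s x) (P t)) \<and>
     (\<forall>x y. ((\<lambda>h. (pmf (P h x) y - of_bool (x = y)) / h) \<longlongrightarrow> G x y) (at_right 0))"

text \<open>The initial distribution (the law of \<open>X 0\<close>) is arbitrary.\<close>

definition ctmc ::
    "'w measure \<Rightarrow> (real \<Rightarrow> 'w \<Rightarrow> 'a) \<Rightarrow> ('a \<Rightarrow> 'a \<Rightarrow> real) \<Rightarrow> bool" where
  "ctmc M X G \<longleftrightarrow>
     prob_space M \<and>
     (\<forall>t\<ge>0. X t \<in> measurable M (count_space UNIV)) \<and>
     (\<exists>P. transition_semigroup G P \<and>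
        (\<forall>n (\<tau> :: nat \<Rightarrow> real) x. 0 \<le> \<tau> 0 \<and> (\<forall>i<n. \<tau> i \<le> \<tau> (Suc i)) \<longrightarrow>
           measure M {\<omega> \<in> space M. \<forall>i\<le>n. X (\<tau> i) \<omega> = x i} =
           measure M {\<omega> \<in> space M. X (\<tau> 0) \<omega> = x 0} *
             (\<Prod>i<n. pmf (P (\<tau> (Suc i) - \<tau> i) (x i)) (x (Suc i)))))"

text \<open>The steady state: an invariant law that is also the limiting law from every initial
  state (hence the only invariant law).\<close>

definition steady_state :: "('a \<Rightarrow> 'a \<Rightarrow> real) \<Rightarrow> 'a pmf \<Rightarrow> bool" where
  "steady_state G p \<longleftrightarrow>
     (\<exists>P. transition_semigroup G P \<and>
        (\<forall>t\<ge>0. bind_pmf p (P t) = p) \<and>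
        (\<forall>x y. ((\<lambda>t. pmf (P t x) y) \<longlongrightarrow> pmf p y) at_top))"

section \<open>Primitives of the model\<close>

text \<open>The regimes \<open>1, \<dots>, K\<close> are the elements of a finite linearly ordered type \<open>'r\<close>,
  with \<open>K = CARD('r)\<close>.\<close>

definition irreducible_generator :: "('r::finite \<Rightarrow> 'r \<Rightarrow> real) \<Rightarrow> bool" where
  "irreducible_generator Q \<longleftrightarrow>
     (\<forall>i j. i \<noteq> j \<longrightarrow> 0 \<le> Q i j) \<and>
     (\<forall>i. (\<Sum>j\<in>UNIV. Q i j) = 0) \<and>
     (\<forall>i j. (i, j) \<in> {(a, b). a \<noteq> b \<and> 0 < Q a b}\<^sup>*)"

definition stationary_distribution :: "('r::finite \<Rightarrow> 'r \<Rightarrow> real) \<Rightarrow> ('r \<Rightarrow> real) \<Rightarrow> bool" where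
  "stationary_distribution Q \<pi> \<longleftrightarrow>
     (\<forall>i. 0 \<le> \<pi> i) \<and> (\<Sum>i\<in>UNIV. \<pi> i) = 1 \<and> (\<forall>j. (\<Sum>i\<in>UNIV. \<pi> i * Q i j) = 0)"

text \<open>Continuity of the density is only asked for on the open interval, so that densities
  with a singularity at an end point are included.\<close>

definition score_law :: "real measure \<Rightarrow> bool" where
  "score_law D \<longleftrightarrow>
     prob_space D \<and>
     (\<exists>f. continuous_on {0<..<1} f \<and> (\<forall>s\<in>{0<..<1}. 0 < f s) \<and>
        D = density lborel (\<lambda>s. ennreal (f s) * indicator {0..1} s))"

definition automation_cost :: "(real \<Rightarrow> 'r::{finite,linorder} \<Rightarrow> real) \<Rightarrow> bool" where
  "automation_cost c \<longleftrightarrow>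
     (\<forall>\<theta>. \<forall>s\<in>{0..1}. 0 \<le> c s \<theta>) \<and>
     (\<forall>\<theta>. strict_mono_on {0..1} (\<lambda>s. c s \<theta>) \<and> continuous_on {0..1} (\<lambda>s. c s \<theta>) \<and>
          convex_on {0..1} (\<lambda>s. c s \<theta>)) \<and>
     (\<forall>s\<in>{0..1}. mono (\<lambda>\<theta>. c s \<theta>)) \<and>
     (\<forall>s\<in>{0..1}. \<forall>s'\<in>{0..1}. \<forall>\<theta> \<theta>'. s < s' \<and> \<theta> < \<theta>' \<longrightarrow>
        c s' \<theta> - c s \<theta> \<le> c s' \<theta>' - c s \<theta>')"

section \<open>Policies and safety\<close>

text \<open>The value \<open>0\<close> means automate and \<open>1\<close> means escalate. Values at scores outside
  \<open>[0,1]\<close> are irrelevant.\<close>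

type_synonym 'r policy = "nat \<Rightarrow> 'r \<Rightarrow> real \<Rightarrow> nat"

definition markov_policy :: "'r policy \<Rightarrow> bool" where
  "markov_policy u \<longleftrightarrow>
     (\<lambda>((q, \<theta>), s). u q \<theta> s)
       \<in> measurable (count_space UNIV \<Otimes>\<^sub>M restrict_space borel {0..1}) (count_space {0, 1})"

text \<open>As the score lies in \<open>[0,1]\<close>, the event \<open>S < \<tau>\<close> is \<open>S \<in> {0..<\<tau>}\<close>; integrating over the
  latter set makes the value independent of \<open>c\<close> outside \<open>[0,1]\<close>.\<close>

definition max_threshold :: "real measure \<Rightarrow> (real \<Rightarrow> 'r \<Rightarrow> real) \<Rightarrow> real \<Rightarrow> 'r \<Rightarrow> real" where
  "max_threshold D c \<epsilon> \<theta> = Sup {\<tau> \<in> {0..1}. (LINT s:{0..<\<tau>}|D. c s \<theta>) \<le> \<epsilon>}"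

definition eps_safe ::
    "real measure \<Rightarrow> (real \<Rightarrow> 'r \<Rightarrow> real) \<Rightarrow> real \<Rightarrow> 'r policy \<Rightarrow> bool" where
  "eps_safe D c \<epsilon> u \<longleftrightarrow>
     (\<forall>q \<theta>. \<forall>s\<in>{0..1}. max_threshold D c \<epsilon> \<theta> < s \<longrightarrow> u q \<theta> s \<noteq> 0)"

definition violation_set ::
    "real measure \<Rightarrow> (real \<Rightarrow> 'r \<Rightarrow> real) \<Rightarrow> real \<Rightarrow> 'r policy \<Rightarrow> ((nat \<times> 'r) \<times> real) set" where
  "violation_set D c \<epsilon> u =
     {((q, \<theta>), s). s \<in> {0..1} \<and> max_threshold D c \<epsilon> \<theta> < s \<and> u q \<theta> s = 0}"

definition min_rate ::
    "real \<Rightarrow> real measure \<Rightarrow> (real \<Rightarrow> 'r \<Rightarrow> real) \<Rightarrow> real \<Rightarrow> 'r \<Rightarrow> real" where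
  "min_rate lam D c \<epsilon> \<theta> = lam * measure D {s. max_threshold D c \<epsilon> \<theta> \<le> s}"

definition required_capacity ::
    "real \<Rightarrow> real measure \<Rightarrow> (real \<Rightarrow> 'r::finite \<Rightarrow> real) \<Rightarrow> real \<Rightarrow> ('r \<Rightarrow> real) \<Rightarrow> real" where
  "required_capacity lam D c \<epsilon> \<pi> = (\<Sum>\<theta>\<in>UNIV. \<pi> \<theta> * min_rate lam D c \<epsilon> \<theta>)"

section \<open>The controlled queue\<close>

text \<open>Generator of the state process \<open>(q(t), \<theta>(t))\<close> under the policy \<open>u\<close>, as the sum of three
  independent mechanisms: at rate \<open>lam\<close> a task arrives with a fresh score \<open>S\<close> of law \<open>D\<close> and the
  state becomes \<open>(q + u q \<theta> S, \<theta>)\<close>; at rate \<open>min(q, m) \<mu>\<close> a service is completed; and the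
  regime moves according to \<open>Q\<close>, whatever the queue does.\<close>

definition system_generator ::
    "real \<Rightarrow> real measure \<Rightarrow> ('r \<Rightarrow> 'r \<Rightarrow> real) \<Rightarrow> nat \<Rightarrow> real \<Rightarrow> 'r policy \<Rightarrow>
     nat \<times> 'r \<Rightarrow> nat \<times> 'r \<Rightarrow> real" where
  "system_generator lam D Q m \<mu> u = (\<lambda>(q, \<theta>) y.
     lam * (measure D {s \<in> {0..1}. (q + u q \<theta> s, \<theta>) = y} - of_bool ((q, \<theta>) = y)) +
     real (min q m) * \<mu> * (of_bool ((q - 1, \<theta>) = y) - of_bool ((q, \<theta>) = y)) +
     (if fst y = q then Q \<theta> (snd y) else 0))"

definition unstable :: "'w measure \<Rightarrow> (real \<Rightarrow> 'w \<Rightarrow> nat \<times> 'r) \<Rightarrow> bool" where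
  "unstable M X \<longleftrightarrow>
     (\<forall>N. ((\<lambda>t. measure M {\<omega> \<in> space M. N < fst (X t \<omega>)}) \<longlongrightarrow> 1) at_top)"

end

theory Submission
  imports Defs
begin

text \<open>
  Write \<open>r \<theta>\<close> for the minimum arrival rate and \<open>\<Lambda> = \<Sum> \<pi> \<theta> * r \<theta>\<close>. Since \<open>Q\<close> is irreducible,
  the Poisson equation \<open>Q h = \<Lambda> - r\<close> has a solution, so that \<open>q + h \<theta>\<close> has constant drift
  \<open>\<Lambda> - m \<mu>\<close> while all servers are busy and arrivals occur at rate \<open>r\<close>. Expanding to first
  order, \<open>exp (\<eta> (q + h \<theta>))\<close> decays exponentially on average for a small \<open>\<eta>\<close> of the opposite sign.

  If \<open>\<Lambda> < m \<mu>\<close>, take the threshold policy with the maximum permissible thresholds. Then \<open>\<eta> > 0\<close>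
  and the exponential is a geometric Lyapunov function. All states reach an empty queue, so
  Harris' theorem gives the steady state, with exponential tails. The semigroup comes from
  uniformization, the rates being bounded.

  If \<open>\<Lambda> > m \<mu>\<close>, a policy whose violation set is null escalates at rate at least \<open>r\<close> in every
  state. Then \<open>\<eta> < 0\<close>, and the exponential is bounded with expectation tending to 0 under any
  semigroup with the given generator, so every state loses its mass.
\<close>

section \<open>Semigroups with bounded rates\<close>

text \<open>A semigroup is only known to have, for each pair of states, a right derivative at 0,
  with no uniformity over the states. Bounded exit rates restore uniformity: the probability of
  sitting in \<open>x\<close> is supermultiplicative in time, hence at least
  \<open>1 - L * t\<close>. This yields Lipschitz continuity in time and the domination needed to
  differentiate expectations of bounded functions. The exponential is treated differently in the two
  regions. Under overload the process comes with an unknown semigroup, so the decay is proved for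
  every one of them; this works because the exponential then takes values in [0,1]. In the stable
  region it is unbounded, but a single semigroup has to be exhibited. It is a Poisson mixture of
  powers of a discrete kernel, for which the drift condition is iterated step by step, without
  differentiation. The Poisson equation makes the first-order term in \<open>\<eta>\<close> the same
  in all regimes; as there are finitely many, one \<open>\<eta>\<close> and one decay rate serve
  them all. A policy enters only through its escalation probability in each state.\<close>

lemma expectation_bind_pmf:
  fixes f :: "'a \<Rightarrow> real"
  assumes "\<And>x. 0 \<le> f x" "\<And>x. f x \<le> B"
  shows "measure_pmf.expectation (bind_pmf p k) f
       = measure_pmf.expectation p (\<lambda>x. measure_pmf.expectation (k x) f)"
proof -
  have int: "integrable (measure_pmf q) f" for q :: "'a pmf"
    using assms by (intro measure_pmf.integrable_const_bound[where B = B]) auto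
  have nonneg: "0 \<le> measure_pmf.expectation q f" for q :: "'a pmf"
    using assms by (simp add: integral_nonneg)
  have le: "measure_pmf.expectation q f \<le> B" for q :: "'a pmf"
    using assms int by (intro measure_pmf.integral_le_const) auto
  have int2: "integrable (measure_pmf p) (\<lambda>x. measure_pmf.expectation (k x) f)"
    using nonneg le by (intro measure_pmf.integrable_const_bound[where B = B]) auto
  have "ennreal (measure_pmf.expectation (bind_pmf p k) f) = (\<integral>\<^sup>+x. \<integral>\<^sup>+y. ennreal (f y) \<partial>k x \<partial>p)"
    using assms int by (subst nn_integral_eq_integral[symmetric]) auto
  also have "\<dots> = (\<integral>\<^sup>+x. ennreal (measure_pmf.expectation (k x) f) \<partial>p)"
    using assms int by (intro nn_integral_cong nn_integral_eq_integral) auto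
  also have "\<dots> = ennreal (measure_pmf.expectation p (\<lambda>x. measure_pmf.expectation (k x) f))"
    using nonneg int2 by (intro nn_integral_eq_integral) auto
  finally show ?thesis
    using nonneg by (simp add: integral_nonneg)
qed

text \<open>Semigroups provide right derivatives only, so the mean value theorem is not at hand.
  Instead a slope \<open>e > 0\<close> is allowed: at the last time \<open>s\<close> with
  \<open>f s \<le> f 0 + e * s\<close> the right derivative is below \<open>e\<close>, which carries
  the inequality past \<open>s\<close>.\<close>

lemma right_derivative_nonpos_decreasing:
  fixes f g :: "real \<Rightarrow> real"
  assumes cont: "continuous_on {0..} f"
    and deriv: "\<And>t. 0 \<le> t \<Longrightarrow> ((\<lambda>h. (f (t + h) - f t) / h) \<longlongrightarrow> g t) (at_right 0)"
    and nonpos: "\<And>t. 0 \<le> t \<Longrightarrow> g t \<le> 0"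
    and "0 \<le> t"
  shows "f t \<le> f 0"
proof -
  have "f t \<le> f 0 + e * t" if "e > 0" for e
  proof (rule ccontr)
    assume contra: "\<not> f t \<le> f 0 + e * t"
    define S where "S = {s \<in> {0..t}. f s \<le> f 0 + e * s}"
    have "closed S"
      unfolding S_def using cont
      by (intro continuous_on_closed_Collect_le continuous_intros)
         (auto intro: continuous_on_subset)
    moreover have "0 \<in> S" using \<open>0 \<le> t\<close> by (simp add: S_def)
    moreover have "bdd_above S" by (auto simp: S_def bdd_above_def)
    ultimately have Sup: "Sup S \<in> S" by (intro closed_contains_Sup) auto
    define s where "s = Sup S"
    have s: "0 \<le> s" "s \<le> t" "f s \<le> f 0 + e * s" using Sup by (auto simp: S_def s_def)
    with contra have "s < t" by (cases "s = t") auto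
    have "eventually (\<lambda>h. (f (s + h) - f s) / h < e) (at_right 0)"
      using nonpos[OF s(1)] \<open>e > 0\<close> by (intro order_tendstoD(2)[OF deriv[OF s(1)]]) auto
    moreover have "eventually (\<lambda>h. h \<in> {0<..<t - s}) (at_right 0)"
      using \<open>s < t\<close> by (intro eventually_at_right_real) auto
    ultimately have "eventually (\<lambda>h. (f (s + h) - f s) / h < e \<and> h \<in> {0<..<t - s}) (at_right 0)"
      by eventually_elim simp
    then obtain h where h: "(f (s + h) - f s) / h < e" "0 < h" "h < t - s"
      using eventually_happens'[OF trivial_limit_at_right_real] by fastforce
    then have "f (s + h) \<le> f 0 + e * (s + h)"
      using s(3) by (simp add: field_simps)
    then have "s + h \<in> S" using h s by (auto simp: S_def)
    then have "s + h \<le> s" unfolding s_def using \<open>bdd_above S\<close> by (rule cSup_upper)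
    with h show False by simp
  qed
  then have le: "f t \<le> f 0 + e * t" if "e > 0" for e using that by blast
  show ?thesis
  proof (rule field_le_epsilon)
    fix e :: real assume "e > 0"
    \<comment> \<open>The \<open>+ 1\<close> keeps the slope defined at
      \<open>t = 0\<close>.\<close>
    have "f t \<le> f 0 + e / (t + 1) * t" using \<open>e > 0\<close> \<open>0 \<le> t\<close> by (intro le) auto
    also have "e / (t + 1) * t \<le> e" using \<open>e > 0\<close> \<open>0 \<le> t\<close> by (simp add: field_simps)
    finally show "f t \<le> f 0 + e" by simp
  qed
qed

text \<open>The integrating factor \<open>exp (k * s)\<close> reduces the differential inequality to
  the monotonicity just shown.\<close>

lemma right_derivative_gronwall:
  fixes f g :: "real \<Rightarrow> real"
  assumes cont: "continuous_on {0..} f"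
    and deriv: "\<And>t. 0 \<le> t \<Longrightarrow> ((\<lambda>h. (f (t + h) - f t) / h) \<longlongrightarrow> g t) (at_right 0)"
    and le: "\<And>t. 0 \<le> t \<Longrightarrow> g t \<le> - k * f t"
    and "0 \<le> t"
  shows "f t \<le> exp (- k * t) * f 0"
proof -
  define F where "F s = exp (k * s) * f s" for s
  have "F t \<le> F 0"
  proof (rule right_derivative_nonpos_decreasing[where g = "\<lambda>s. exp (k * s) * (g s + k * f s)"])
    show "continuous_on {0..} F"
      unfolding F_def using cont by (intro continuous_intros)
    show "exp (k * s) * (g s + k * f s) \<le> 0" if "0 \<le> s" for s
      using le[OF that] by (simp add: mult_le_0_iff)
    show "((\<lambda>h. (F (s + h) - F s) / h) \<longlongrightarrow> exp (k * s) * (g s + k * f s)) (at_right 0)"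
      if "0 \<le> s" for s
    proof -
      have "((\<lambda>h. exp (k * h)) has_real_derivative k) (at 0)"
        by (auto intro!: derivative_eq_intros)
      then have e: "((\<lambda>h. (exp (k * h) - 1) / h) \<longlongrightarrow> k) (at_right 0)"
        by (simp add: DERIV_def filterlim_at_split)
      have 1: "((\<lambda>h::real. exp (k * h)) \<longlongrightarrow> exp (k * 0)) (at_right 0)"
        by (intro tendsto_intros)
      have "((\<lambda>h. exp (k * s) * (exp (k * h) * ((f (s + h) - f s) / h) + (exp (k * h) - 1) / h * f s))
             \<longlongrightarrow> exp (k * s) * (exp (k * 0) * g s + k * f s)) (at_right 0)"
        by (intro tendsto_intros 1 e deriv that)
      then show ?thesis
        by (simp add: F_def exp_add algebra_simps diff_divide_distrib)
    qed
  qed fact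
  then have "exp (- k * t) * (exp (k * t) * f t) \<le> exp (- k * t) * f 0"
    by (intro mult_left_mono) (simp_all add: F_def)
  then show ?thesis by (simp add: mult.assoc[symmetric] exp_add[symmetric])
qed

text \<open>Finite neighbourhoods turn the action of \<open>G\<close> on functions into finite sums.
  The strict rate bound leaves room for \<open>(pmf (P h x) x - 1) / h\<close> to exceed
  \<open>- L\<close> already for small positive \<open>h\<close>, not only in the limit.\<close>

locale bounded_generator =
  fixes G :: "'a \<Rightarrow> 'a \<Rightarrow> real" and N :: "'a \<Rightarrow> 'a set" and L :: real
  assumes finite_nbrs: "finite (N x)" and self_nbr: "x \<in> N x"
    and zero_off_nbrs: "y \<notin> N x \<Longrightarrow> G x y = 0"
    and nonneg_off_diag: "x \<noteq> y \<Longrightarrow> 0 \<le> G x y"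
    and row_sum: "(\<Sum>y\<in>N x. G x y) = 0"
    and rate_less: "- G x x < L"
begin

definition gen :: "('a \<Rightarrow> real) \<Rightarrow> 'a \<Rightarrow> real" where
  "gen f x = (\<Sum>y\<in>N x. G x y * f y)"

lemma diag_nonpos: "G x x \<le> 0"
proof -
  have "G x x = - (\<Sum>y\<in>N x - {x}. G x y)"
    using row_sum[of x] by (simp add: sum.remove[OF finite_nbrs self_nbr])
  also have "\<dots> \<le> 0" by (auto intro!: sum_nonneg nonneg_off_diag)
  finally show ?thesis .
qed

lemma rate_bound_pos: "0 < L"
  using diag_nonpos rate_less by (meson le_less_trans neg_0_le_iff_le)

section \<open>The forward equation for bounded functions, under an arbitrary semigroup\<close>

context
  fixes P :: "real \<Rightarrow> 'a \<Rightarrow> 'a pmf"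
  assumes semigroup: "transition_semigroup G P"
begin

lemma semigroup_0: "P 0 x = return_pmf x"
  and semigroup_add: "0 \<le> s \<Longrightarrow> 0 \<le> t \<Longrightarrow> P (s + t) x = bind_pmf (P s x) (P t)"
  and semigroup_deriv: "((\<lambda>h. (pmf (P h x) y - of_bool (x = y)) / h) \<longlongrightarrow> G x y) (at_right 0)"
  using semigroup unfolding transition_semigroup_def by blast+

text \<open>Chapman-Kolmogorov, keeping only the paths that are at \<open>x\<close> at the
  intermediate time.\<close>

lemma pmf_stay_add:
  assumes "0 \<le> s" "0 \<le> t"
  shows "pmf (P s x) x * pmf (P t x) x \<le> pmf (P (s + t) x) x"
proof -
  have "pmf (P s x) x * pmf (P t x) x
      = measure_pmf.expectation (P s x) (\<lambda>z. indicator {x} z * pmf (P t x) x)"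
    by (simp add: measure_pmf_single)
  also have "\<dots> \<le> measure_pmf.expectation (P s x) (\<lambda>z. pmf (P t z) x)"
    by (intro integral_mono measure_pmf.integrable_const_bound[where B = 1])
       (auto simp: pmf_le_1 pmf_nonneg indicator_def)
  finally show ?thesis
    by (simp add: semigroup_add[OF assms] pmf_bind)
qed

lemma pmf_stay_power:
  assumes "0 \<le> s"
  shows "pmf (P s x) x ^ n \<le> pmf (P (real n * s) x) x"
proof (induction n)
  case 0
  then show ?case by (simp add: semigroup_0)
next
  case (Suc n)
  have "pmf (P s x) x ^ Suc n \<le> pmf (P s x) x * pmf (P (real n * s) x) x"
    using Suc by (simp add: mult_left_mono)
  also have "\<dots> \<le> pmf (P (s + real n * s) x) x"
    using assms by (intro pmf_stay_add) auto
  finally show ?case by (simp add: algebra_simps)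
qed

text \<open>The derivative at 0 gives this only for times below some \<open>d\<close> that depends
  on \<open>x\<close>. Cutting \<open>t\<close> into \<open>n\<close> steps shorter than
  \<open>d\<close>, multiplying the one-step bounds and applying Bernoulli's inequality removes
  \<open>d\<close>, so the bound is uniform in \<open>x\<close>.\<close>

lemma pmf_stay_ge:
  assumes "0 \<le> t"
  shows "1 - L * t \<le> pmf (P t x) x"
proof (cases "t = 0 \<or> 1 \<le> L * t")
  case True
  then show ?thesis using pmf_nonneg[of "P t x" x] by (auto simp: semigroup_0 simp del: pmf_nonneg)
next
  case False
  then have t: "0 < t" "L * t < 1" using assms by auto
  have "eventually (\<lambda>h. - L < (pmf (P h x) x - of_bool (x = x)) / h) (at_right 0)"
    using rate_less[of x] by (intro order_tendstoD(1)[OF semigroup_deriv]) auto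
  then obtain d where d: "0 < d" "\<And>h. 0 < h \<Longrightarrow> h < d \<Longrightarrow> - L < (pmf (P h x) x - 1) / h"
    by (auto simp: eventually_at_right_field)
  obtain n :: nat where n: "t / d < real n" "0 < n"
    using reals_Archimedean2[of "max (t / d) 1"] by (metis max_less_iff_conj of_nat_0_less_iff less_trans zero_less_one)
  define h where "h = t / real n"
  have h: "0 < h" "h < d" using n t d by (auto simp: h_def field_simps)
  have step: "1 - L * h \<le> pmf (P h x) x"
    using d(2)[OF h] h by (simp add: field_simps)
  have Lh: "L * h \<le> 1"
  proof -
    have "L * h \<le> L * t" using n t rate_bound_pos by (simp add: h_def field_simps)
    with t show ?thesis by simp
  qed
  have "1 - L * t = 1 + real n * (- (L * h))" using n by (simp add: h_def)
  also have "\<dots> \<le> (1 + - (L * h)) ^ n" using Lh by (intro Bernoulli_inequality) auto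
  also have "\<dots> \<le> pmf (P h x) x ^ n" using step Lh by (intro power_mono) auto
  also have "\<dots> \<le> pmf (P (real n * h) x) x" using h by (intro pmf_stay_power) auto
  also have "real n * h = t" using n by (simp add: h_def)
  finally show ?thesis .
qed

context
  fixes W :: "'a \<Rightarrow> real"
  assumes W_nonneg: "\<And>x. 0 \<le> W x" and W_le_1: "\<And>x. W x \<le> 1"
begin

lemma integrable_W: "integrable (measure_pmf p) W"
  using W_nonneg W_le_1 by (intro measure_pmf.integrable_const_bound[where B = 1]) auto

text \<open>\<open>W\<close> changes by at most 1, and only if the state differs from
  \<open>x\<close>, which has probability at most \<open>L * h\<close>. As the bound is independent
  of \<open>x\<close>, it serves as Lipschitz constant and as dominating function below.\<close>

lemma expectation_increment_le:
  assumes "0 \<le> h"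
  shows "\<bar>measure_pmf.expectation (P h x) W - W x\<bar> \<le> L * h"
proof -
  have "\<bar>measure_pmf.expectation (P h x) W - W x\<bar>
      = \<bar>measure_pmf.expectation (P h x) (\<lambda>z. W z - W x)\<bar>"
    by (subst Bochner_Integration.integral_diff) (auto simp: integrable_W)
  also have "\<dots> \<le> measure_pmf.expectation (P h x) (\<lambda>z. \<bar>W z - W x\<bar>)"
    by (rule integral_abs_bound)
  also have "\<dots> \<le> measure_pmf.expectation (P h x) (\<lambda>z. 1 - indicator {x} z)"
  proof (intro integral_mono measure_pmf.integrable_const_bound[where B = 1])
    show "\<bar>W z - W x\<bar> \<le> 1 - indicator {x} z" for z
      using W_nonneg[of z] W_nonneg[of x] W_le_1[of z] W_le_1[of x] by (auto simp: indicator_def)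
    show "AE z in P h x. norm \<bar>W z - W x\<bar> \<le> 1"
    proof (rule AE_I2)
      fix z
      show "norm \<bar>W z - W x\<bar> \<le> 1"
        using W_nonneg[of z] W_nonneg[of x] W_le_1[of z] W_le_1[of x] by simp
    qed
  qed (auto simp: indicator_def)
  also have "\<dots> = 1 - pmf (P h x) x"
    by (subst Bochner_Integration.integral_diff)
       (auto simp: measure_pmf_single intro: measure_pmf.integrable_const_bound[where B = 1])
  also have "\<dots> \<le> L * h" using pmf_stay_ge[OF assms, of x] by simp
  finally show ?thesis .
qed

lemma expectation_deriv_0:
  "((\<lambda>h. (measure_pmf.expectation (P h x) W - W x) / h) \<longlongrightarrow> gen W x) (at_right 0)"
proof -
  define A where "A h = (\<Sum>y\<in>N x. (pmf (P h x) y - of_bool (x = y)) / h * W y)" for h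
  \<comment> \<open>\<open>h * R h\<close> is the mass that \<open>P h x\<close> puts outside
    \<open>N x\<close>; it is of smaller order than \<open>h\<close> because the row of
    \<open>G\<close> sums to 0 over \<open>N x\<close>.\<close>
  define R where "R h = - (\<Sum>y\<in>N x. (pmf (P h x) y - of_bool (x = y)) / h)" for h
  have A: "(A \<longlongrightarrow> gen W x) (at_right 0)"
    unfolding A_def gen_def by (intro tendsto_intros semigroup_deriv)
  have "(R \<longlongrightarrow> - (\<Sum>y\<in>N x. G x y)) (at_right 0)"
    unfolding R_def by (intro tendsto_intros semigroup_deriv)
  then have R: "(R \<longlongrightarrow> 0) (at_right 0)" by (simp add: row_sum)
  have bound: "\<bar>(measure_pmf.expectation (P h x) W - W x) / h - A h\<bar> \<le> R h" if "0 < h" for h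
  proof -
    have delta: "(\<Sum>y\<in>N x. of_bool (x = y) * g y) = g x" for g :: "'a \<Rightarrow> real"
      using finite_nbrs self_nbr by (subst sum.remove[where x = x]) (auto intro: sum.neutral)
    have "measure_pmf.expectation (P h x) W
        = measure_pmf.expectation (P h x) (\<lambda>y. indicator (N x) y * W y)
        + measure_pmf.expectation (P h x) (\<lambda>y. indicator (- N x) y * W y)"
      using W_nonneg W_le_1
      by (subst Bochner_Integration.integral_add[symmetric])
         (auto intro!: measure_pmf.integrable_const_bound[where B = 1] Bochner_Integration.integral_cong simp: indicator_def)
    also have "measure_pmf.expectation (P h x) (\<lambda>y. indicator (N x) y * W y)
        = (\<Sum>y\<in>N x. pmf (P h x) y * W y)"
      using finite_nbrs by (subst integral_measure_pmf[of "N x"]) (auto simp: indicator_def)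
    finally have eq: "(measure_pmf.expectation (P h x) W - W x) / h - A h
        = measure_pmf.expectation (P h x) (\<lambda>y. indicator (- N x) y * W y) / h"
      using delta[of W]
      by (simp add: A_def left_diff_distrib sum_subtractf sum_divide_distrib[symmetric] diff_divide_distrib add_divide_distrib)
    have "measure_pmf.expectation (P h x) (\<lambda>y. indicator (- N x) y * W y)
        \<le> measure_pmf.expectation (P h x) (indicator (- N x))"
      using W_nonneg W_le_1
      by (intro integral_mono measure_pmf.integrable_const_bound[where B = 1]) (auto simp: indicator_def)
    also have "\<dots> = 1 - (\<Sum>y\<in>N x. pmf (P h x) y)"
      using finite_nbrs by (simp add: measure_pmf.prob_compl[of "N x", simplified, folded Compl_eq_Diff_UNIV] measure_measure_pmf_finite)
    also have "\<dots> = h * R h"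
      using delta[of "\<lambda>_. 1"] that
      by (simp add: R_def sum_divide_distrib[symmetric] sum_subtractf)
    finally have "measure_pmf.expectation (P h x) (\<lambda>y. indicator (- N x) y * W y) / h \<le> R h"
      using that by (simp add: field_simps)
    moreover have "0 \<le> measure_pmf.expectation (P h x) (\<lambda>y. indicator (- N x) y * W y) / h"
      using that W_nonneg by (intro divide_nonneg_pos integral_nonneg) auto
    ultimately show ?thesis by (simp add: eq)
  qed
  have "((\<lambda>h. (measure_pmf.expectation (P h x) W - W x) / h - A h) \<longlongrightarrow> 0) (at_right 0)"
    by (rule Lim_null_comparison[OF _ R])
       (use bound in \<open>auto simp: eventually_at_right_field intro: exI[of _ 1]\<close>)
  from tendsto_add[OF this A] show ?thesis by simp
qed

lemma expectation_add:
  assumes "0 \<le> s" "0 \<le> t"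
  shows "measure_pmf.expectation (P (s + t) x) W
       = measure_pmf.expectation (P s x) (\<lambda>z. measure_pmf.expectation (P t z) W)"
  using W_nonneg W_le_1 by (simp add: semigroup_add[OF assms] expectation_bind_pmf[where B = 1])

lemma integrable_expectation_W:
  "integrable (measure_pmf p) (\<lambda>z. measure_pmf.expectation (P t z) W)"
  using W_nonneg W_le_1 integrable_W
  by (intro measure_pmf.integrable_const_bound[where B = 1])
     (auto simp: integral_nonneg intro!: measure_pmf.integral_le_const)

lemma expectation_diff:
  assumes "0 \<le> t" "0 \<le> h"
  shows "measure_pmf.expectation (P (t + h) x) W - measure_pmf.expectation (P t x) W
       = measure_pmf.expectation (P t x) (\<lambda>z. measure_pmf.expectation (P h z) W - W z)"
  by (subst Bochner_Integration.integral_diff)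
     (auto simp: integrable_W integrable_expectation_W expectation_add[OF assms])

lemma continuous_expectation: "continuous_on {0..} (\<lambda>t. measure_pmf.expectation (P t x) W)"
proof -
  have le: "\<bar>measure_pmf.expectation (P t x) W - measure_pmf.expectation (P s x) W\<bar> \<le> L * (t - s)"
    if "0 \<le> s" "s \<le> t" for s t
  proof -
    have "\<bar>measure_pmf.expectation (P (s + (t - s)) x) W - measure_pmf.expectation (P s x) W\<bar>
        \<le> measure_pmf.expectation (P s x) (\<lambda>z. \<bar>measure_pmf.expectation (P (t - s) z) W - W z\<bar>)"
      using that by (subst expectation_diff) (auto intro: integral_abs_bound)
    also have "\<dots> \<le> L * (t - s)"
      using that expectation_increment_le[of "t - s"]
      by (intro measure_pmf.integral_le_const integrable_abs Bochner_Integration.integrable_diff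
             integrable_W integrable_expectation_W) auto
    finally show ?thesis by simp
  qed
  have "L-lipschitz_on {0..} (\<lambda>t. measure_pmf.expectation (P t x) W)"
  proof (rule lipschitz_onI)
    fix s t :: real assume "s \<in> {0..}" "t \<in> {0..}"
    then show "dist (measure_pmf.expectation (P s x) W) (measure_pmf.expectation (P t x) W)
        \<le> L * dist s t"
      using le[of s t] le[of t s] by (cases "s \<le> t") (auto simp: dist_real_def abs_minus_commute)
  qed (use rate_bound_pos in simp)
  then show ?thesis by (rule lipschitz_on_continuous_on)
qed

text \<open>The increment after time \<open>t\<close> is the average, over the state at time
  \<open>t\<close>, of increments from time 0. The quotients are bounded by \<open>L\<close>, so
  dominated convergence moves the limit inside; it applies to sequences, hence the passage to a
  sequence \<open>S\<close>.\<close>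

lemma expectation_right_deriv:
  assumes "0 \<le> t"
  shows "((\<lambda>h. (measure_pmf.expectation (P (t + h) x) W - measure_pmf.expectation (P t x) W) / h)
      \<longlongrightarrow> measure_pmf.expectation (P t x) (gen W)) (at_right 0)"
proof (rule tendsto_at_right_sequentially[of 0 1])
  fix S :: "nat \<Rightarrow> real" assume S: "\<And>n. 0 < S n" "S \<longlonglongrightarrow> 0"
  then have S': "filterlim S (at_right 0) sequentially"
    by (auto simp: filterlim_at less_imp_neq[symmetric] intro!: always_eventually)
  have eq: "(measure_pmf.expectation (P (t + S n) x) W - measure_pmf.expectation (P t x) W) / S n
      = measure_pmf.expectation (P t x) (\<lambda>z. (measure_pmf.expectation (P (S n) z) W - W z) / S n)" for n
    using expectation_diff[OF assms less_imp_le[OF S(1)]] by simp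
  show "(\<lambda>n. (measure_pmf.expectation (P (t + S n) x) W - measure_pmf.expectation (P t x) W) / S n)
      \<longlonglongrightarrow> measure_pmf.expectation (P t x) (gen W)"
    unfolding eq
  proof (rule integral_dominated_convergence[where w = "\<lambda>_. L"])
    show "AE z in P t x. (\<lambda>n. (measure_pmf.expectation (P (S n) z) W - W z) / S n) \<longlonglongrightarrow> gen W z"
      using filterlim_compose[OF expectation_deriv_0 S'] by auto
    show "AE z in P t x. norm ((measure_pmf.expectation (P (S n) z) W - W z) / S n) \<le> L" for n
      using expectation_increment_le[OF less_imp_le[OF S(1)]] S(1)[of n]
      by (simp add: pos_divide_le_eq)
  qed auto
qed simp

lemma expectation_exp_decay:
  assumes drift: "\<And>x. gen W x \<le> - k * W x" and "0 \<le> t"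
  shows "measure_pmf.expectation (P t x) W \<le> exp (- k * t) * W x"
proof -
  \<comment> \<open>Obtained as a limit of quotients bounded by \<open>L\<close>; it makes
    \<open>gen W\<close> integrable.\<close>
  have "\<bar>gen W z\<bar> \<le> L" for z
  proof (rule tendsto_le[OF _ tendsto_const tendsto_rabs[OF expectation_deriv_0]])
    show "\<forall>\<^sub>F h in at_right 0. \<bar>(measure_pmf.expectation (P h z) W - W z) / h\<bar> \<le> L"
      using expectation_increment_le
      by (auto simp: eventually_at_right_field pos_divide_le_eq abs_divide intro!: exI[of _ 1])
  qed auto
  then have int: "integrable (measure_pmf (P t x)) (gen W)" for t
    by (intro measure_pmf.integrable_const_bound[where B = L]) auto
  have "measure_pmf.expectation (P t x) W \<le> exp (- k * t) * measure_pmf.expectation (P 0 x) W"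
  proof (rule right_derivative_gronwall[where f = "\<lambda>t. measure_pmf.expectation (P t x) W",
        OF continuous_expectation expectation_right_deriv])
    fix s :: real assume "0 \<le> s"
    have "measure_pmf.expectation (P s x) (gen W) \<le> measure_pmf.expectation (P s x) (\<lambda>z. - k * W z)"
      using drift by (intro integral_mono int integrable_mult_right integrable_W) auto
    then show "measure_pmf.expectation (P s x) (gen W) \<le> - k * measure_pmf.expectation (P s x) W"
      by simp
  qed (use \<open>0 \<le> t\<close> in auto)
  then show ?thesis by (simp add: semigroup_0)
qed

end

end

end

section \<open>Poisson equation and exponential tilting\<close>

text \<open>Maximum principle: where \<open>h\<close> attains its maximum, a vanishing sum of
  nonnegative terms forces every regime reachable in one jump to attain it too, and irreducibility
  spreads this everywhere.\<close>

lemma irreducible_harmonic_const: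
  fixes Q :: "'r::finite \<Rightarrow> 'r \<Rightarrow> real"
  assumes "irreducible_generator Q" and harm: "\<And>i. (\<Sum>j\<in>UNIV. Q i j * h j) = 0"
  shows "h i = h j"
proof -
  have off: "\<And>i j. i \<noteq> j \<Longrightarrow> 0 \<le> Q i j" and row: "\<And>i. (\<Sum>j\<in>UNIV. Q i j) = 0"
    and irr: "\<And>i j. (i, j) \<in> {(a, b). a \<noteq> b \<and> 0 < Q a b}\<^sup>*"
    using assms(1) unfolding irreducible_generator_def by blast+
  define M where "M = Max (range h)"
  have le: "h j \<le> M" for j by (simp add: M_def)
  obtain i0 where i0: "h i0 = M"
    using Max_in[of "range h"] unfolding M_def by fastforce
  have "h j = M" for j
    using irr[of i0 j]
  proof (induction rule: rtrancl_induct)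
    case base
    show ?case by (rule i0)
  next
    case (step a b)
    have "(\<Sum>j\<in>UNIV. Q a j * (M - h j)) = 0"
      using harm[of a] row[of a]
      by (simp add: right_diff_distrib sum_subtractf sum_distrib_right[symmetric])
    moreover have "0 \<le> Q a j * (M - h j)" for j
      using le[of j] off[of a j] step.IH by (cases "a = j") auto
    ultimately have "Q a b * (M - h b) = 0"
      by (subst (asm) sum_nonneg_eq_0_iff) auto
    with step.hyps show ?case by auto
  qed
  then show ?thesis by simp
qed

text \<open>The operator \<open>h \<mapsto> Q h + (\<pi> \<bullet> h) 1\<close> is injective, hence onto.\<close>

lemma poisson_equation_solvable:
  fixes Q :: "'r::finite \<Rightarrow> 'r \<Rightarrow> real"
  assumes "irreducible_generator Q" and "stationary_distribution Q \<pi>"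
  obtains h where "\<And>i. 0 \<le> h i"
    "\<And>i. (\<Sum>j\<in>UNIV. Q i j * h j) = (\<Sum>k\<in>UNIV. \<pi> k * a k) - a i"
proof -
  have row: "\<And>i. (\<Sum>j\<in>UNIV. Q i j) = 0"
    using assms(1) unfolding irreducible_generator_def by blast
  have tot: "(\<Sum>i\<in>UNIV. \<pi> i) = 1" and inv: "\<And>j. (\<Sum>i\<in>UNIV. \<pi> i * Q i j) = 0"
    using assms(2) unfolding stationary_distribution_def by blast+
  define T :: "real^'r \<Rightarrow> real^'r" where
    "T h = (\<chi> i. (\<Sum>j\<in>UNIV. Q i j * h $ j) + (\<Sum>k\<in>UNIV. \<pi> k * h $ k))" for h
  \<comment> \<open>Averaging with \<open>\<pi>\<close> kills the \<open>Q\<close> part. Hence the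
    rank-one term vanishes both for elements of the kernel of \<open>T\<close> and for the solution
    found below, leaving an equation in \<open>Q\<close> alone.\<close>
  have avg: "(\<Sum>i\<in>UNIV. \<pi> i * T h $ i) = (\<Sum>k\<in>UNIV. \<pi> k * h $ k)" for h
  proof -
    have "(\<Sum>i\<in>UNIV. \<pi> i * (\<Sum>j\<in>UNIV. Q i j * h $ j)) = (\<Sum>j\<in>UNIV. (\<Sum>i\<in>UNIV. \<pi> i * Q i j) * h $ j)"
      unfolding sum_distrib_left sum_distrib_right by (subst sum.swap) (simp add: mult.assoc)
    then show ?thesis
      by (simp add: T_def distrib_left sum.distrib inv tot sum_distrib_right[symmetric])
  qed
  have lin: "linear T"
    by (rule linearI)
       (simp_all add: T_def vec_eq_iff algebra_simps sum.distrib sum_distrib_left)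
  moreover have "inj T"
  proof (subst linear_injective_0[OF lin], intro allI impI)
    fix h assume T0: "T h = 0"
    then have pi0: "(\<Sum>k\<in>UNIV. \<pi> k * h $ k) = 0" using avg[of h] by simp
    have "(\<Sum>j\<in>UNIV. Q i j * h $ j) = 0" for i
      using arg_cong[OF T0, of "\<lambda>v. v $ i"] by (simp add: T_def pi0)
    then have const: "h $ k = h $ i" for i k
      by (rule irreducible_harmonic_const[OF assms(1)])
    have "h $ i = 0" for i
    proof -
      have "(\<Sum>k\<in>UNIV. \<pi> k * h $ k) = (\<Sum>k\<in>UNIV. \<pi> k * h $ i)"
        by (intro sum.cong refl arg_cong2[where f = "(*)"] const)
      then show ?thesis using pi0 tot by (simp add: sum_distrib_right[symmetric])
    qed
    then show "h = 0" by (simp add: vec_eq_iff)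
  qed
  ultimately have "surj T" by (rule linear_injective_imp_surjective) (rule refl)
  then obtain h where h: "T h = (\<chi> i. (\<Sum>k\<in>UNIV. \<pi> k * a k) - a i)" by (metis surjD)
  have "(\<Sum>k\<in>UNIV. \<pi> k * h $ k) = 0"
    using avg[of h] unfolding h
    by (simp add: right_diff_distrib sum_subtractf sum_distrib_right[symmetric] tot)
  then have sol: "(\<Sum>j\<in>UNIV. Q i j * h $ j) = (\<Sum>k\<in>UNIV. \<pi> k * a k) - a i" for i
    using arg_cong[OF h, of "\<lambda>v. v $ i"] by (simp add: T_def)
  \<comment> \<open>Rows of \<open>Q\<close> sum to 0, so subtracting a constant preserves the
    equation and allows \<open>h\<close> to be made nonnegative.\<close>
  define c where "c = Min (range (\<lambda>i. h $ i))"
  show ?thesis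
  proof (rule that[of "\<lambda>i. h $ i - c"])
    show "0 \<le> h $ i - c" for i by (simp add: c_def)
    show "(\<Sum>j\<in>UNIV. Q i j * (h $ j - c)) = (\<Sum>k\<in>UNIV. \<pi> k * a k) - a i" for i
      using sol[of i] by (simp add: right_diff_distrib sum_subtractf sum_distrib_right[symmetric] row)
  qed
qed

text \<open>The relative drift of \<open>exp (\<eta> (q + h \<theta>))\<close> while all servers are busy, where \<open>a\<close> is the
  arrival rate and \<open>d\<close> the total service rate.\<close>

definition tilted_drift ::
    "('r::finite \<Rightarrow> 'r \<Rightarrow> real) \<Rightarrow> ('r \<Rightarrow> real) \<Rightarrow> real \<Rightarrow> ('r \<Rightarrow> real) \<Rightarrow> real \<Rightarrow> 'r \<Rightarrow> real" where
  "tilted_drift Q a d h \<eta> i =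
     a i * (exp \<eta> - 1) + d * (exp (- \<eta>) - 1) + (\<Sum>j\<in>UNIV. Q i j * exp (\<eta> * (h j - h i)))"

lemma tilted_drift_0:
  assumes "\<And>i. (\<Sum>j\<in>UNIV. Q i j) = 0"
  shows "tilted_drift Q a d h 0 i = 0"
  by (simp add: tilted_drift_def assms)

text \<open>The arrival rate \<open>a i\<close> cancels against the right-hand side of the Poisson
  equation, which is why the slope is independent of the regime.\<close>

lemma tilted_drift_deriv:
  assumes "\<And>i. (\<Sum>j\<in>UNIV. Q i j) = 0" and "(\<Sum>j\<in>UNIV. Q i j * h j) = r - a i"
  shows "((\<lambda>\<eta>. tilted_drift Q a d h \<eta> i) has_real_derivative r - d) (at 0)"
proof -
  have "((\<lambda>\<eta>. tilted_drift Q a d h \<eta> i) has_real_derivative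
      a i - d + (\<Sum>j\<in>UNIV. Q i j * (h j - h i))) (at 0)"
    unfolding tilted_drift_def by (auto intro!: derivative_eq_intros sum.cong)
  moreover have "(\<Sum>j\<in>UNIV. Q i j * (h j - h i)) = r - a i"
    using assms by (simp add: right_diff_distrib sum_subtractf sum_distrib_right[symmetric])
  ultimately show ?thesis by simp
qed

text \<open>The tilted drift vanishes at 0 and has slope \<open>\<sigma> * (r - d) < 0\<close> in
  the direction \<open>\<sigma>\<close>, so it is negative shortly after 0. The sign
  \<open>\<sigma>\<close> is 1 for the stable and -1 for the overloaded queue.\<close>

lemma tilted_drift_neg:
  fixes Q :: "'r::finite \<Rightarrow> 'r \<Rightarrow> real"
  assumes row: "\<And>i. (\<Sum>j\<in>UNIV. Q i j) = 0"
    and poisson: "\<And>i. (\<Sum>j\<in>UNIV. Q i j * h j) = r - a i"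
    and sign: "\<sigma> * (r - d) < 0"
  obtains \<eta> k where "0 < \<eta>" "0 < k" "\<And>i. tilted_drift Q a d h (\<sigma> * \<eta>) i \<le> - k"
proof -
  have "\<exists>e>0. \<forall>\<eta>>0. \<eta> < e \<longrightarrow> tilted_drift Q a d h (\<sigma> * \<eta>) i < 0" for i
  proof -
    have "((\<lambda>\<eta>. tilted_drift Q a d h \<eta> i) has_real_derivative r - d) (at (\<sigma> * 0))"
      using tilted_drift_deriv[where Q = Q and a = a and i = i, OF row poisson] by simp
    then have "((\<lambda>\<eta>. tilted_drift Q a d h (\<sigma> * \<eta>) i) has_real_derivative (r - d) * \<sigma>) (at 0)"
      by (rule DERIV_chain2) (auto intro!: derivative_eq_intros)
    from DERIV_neg_dec_right[OF this] show ?thesis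
      using sign by (simp add: tilted_drift_0[OF row] mult.commute)
  qed
  then obtain e where e: "\<And>i. 0 < e i"
      "\<And>i \<eta>. 0 < \<eta> \<Longrightarrow> \<eta> < e i \<Longrightarrow> tilted_drift Q a d h (\<sigma> * \<eta>) i < 0"
    by metis
  \<comment> \<open>Halving puts \<open>\<eta>\<close> strictly below every
    \<open>e i\<close>.\<close>
  define \<eta> where "\<eta> = Min (range e) / 2"
  have pos: "0 < Min (range e)" using e(1) by (subst Min_gr_iff) auto
  then have \<eta>: "0 < \<eta>" by (simp add: \<eta>_def)
  have less: "\<eta> < e i" for i
  proof -
    have "Min (range e) \<le> e i" by (rule Min_le) auto
    then have "\<eta> \<le> e i / 2" by (simp add: \<eta>_def)
    with e(1)[of i] show ?thesis by linarith
  qed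
  define k where "k = Min (range (\<lambda>i. - tilted_drift Q a d h (\<sigma> * \<eta>) i))"
  have "0 < k" unfolding k_def using e(2)[OF \<eta> less] by (subst Min_gr_iff) auto
  moreover have "k \<le> - tilted_drift Q a d h (\<sigma> * \<eta>) i" for i by (simp add: k_def)
  ultimately show ?thesis using that[of \<eta> k] \<eta> by (metis le_minus_iff)
qed

section \<open>Uniformization\<close>

text \<open>The library specifies \<open>poisson_pmf\<close> for positive rates only; the semigroup starts at rate 0.\<close>

definition poisson_count :: "real \<Rightarrow> nat pmf" where
  "poisson_count r = (if 0 < r then poisson_pmf r else return_pmf 0)"

lemma pmf_poisson_count:
  assumes "0 \<le> r"
  shows "pmf (poisson_count r) n = r ^ n / fact n * exp (- r)"
  using assms by (cases n) (auto simp: poisson_count_def)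

text \<open>The convolution of the two laws is summed by the binomial theorem; this is the semigroup
  law of the Poisson clock.\<close>

lemma poisson_count_add:
  assumes "0 \<le> r" "0 \<le> s"
  shows "poisson_count (r + s)
       = bind_pmf (poisson_count r) (\<lambda>i. bind_pmf (poisson_count s) (\<lambda>j. return_pmf (i + j)))"
proof (rule pmf_eqI)
  fix n
  have inner: "pmf (bind_pmf (poisson_count s) (\<lambda>j. return_pmf (i + j))) n
      = (if i \<le> n then pmf (poisson_count s) (n - i) else 0)" for i
  proof -
    have "pmf (bind_pmf (poisson_count s) (\<lambda>j. return_pmf (i + j))) n
        = measure_pmf.expectation (poisson_count s) (indicator {j. i + j = n})"
      unfolding pmf_bind by (intro Bochner_Integration.integral_cong) (auto simp: indicator_def)
    also have "{j. i + j = n} = (if i \<le> n then {n - i} else {})" by auto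
    finally show ?thesis by (simp add: measure_pmf_single)
  qed
  have "pmf (bind_pmf (poisson_count r) (\<lambda>i. bind_pmf (poisson_count s) (\<lambda>j. return_pmf (i + j)))) n
      = (\<Sum>i\<le>n. pmf (poisson_count r) i * pmf (poisson_count s) (n - i))"
    by (subst pmf_bind, unfold inner, subst integral_measure_pmf[of "{..n}"]) (auto split: if_splits)
  also have "\<dots> = (\<Sum>i\<le>n. (n choose i) * r ^ i * s ^ (n - i)) * (exp (- (r + s)) / fact n)"
    unfolding sum_distrib_right using assms
    by (intro sum.cong) (auto simp: pmf_poisson_count binomial_fact exp_add[symmetric] field_simps)
  also have "\<dots> = pmf (poisson_count (r + s)) n"
    using assms by (simp add: binomial_ring pmf_poisson_count)
  finally show "pmf (poisson_count (r + s)) n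
      = pmf (bind_pmf (poisson_count r) (\<lambda>i. bind_pmf (poisson_count s) (\<lambda>j. return_pmf (i + j)))) n"
    by simp
qed

text \<open>The Poisson generating function. It converts a contraction by \<open>g\<close> per step
  into exponential decay in continuous time.\<close>

lemma nn_integral_poisson_count_power:
  assumes "0 \<le> r" "0 \<le> g"
  shows "(\<integral>\<^sup>+n. ennreal (g ^ n) \<partial>poisson_count r) = ennreal (exp (- r * (1 - g)))"
proof -
  have sums: "(\<lambda>n. (r * g) ^ n / fact n * exp (- r)) sums (exp (r * g) * exp (- r))"
    using exp_converges[of "r * g"] by (intro sums_mult2) (simp add: field_simps)
  have "(\<integral>\<^sup>+n. ennreal (g ^ n) \<partial>poisson_count r) = (\<integral>\<^sup>+n. ennreal ((r * g) ^ n / fact n * exp (- r)) \<partial>count_space UNIV)"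
    unfolding nn_integral_measure_pmf using assms
    by (intro nn_integral_cong) (auto simp: pmf_poisson_count ennreal_mult[symmetric] power_mult_distrib field_simps)
  also have "\<dots> = (\<Sum>n. ennreal ((r * g) ^ n / fact n * exp (- r)))"
    by (rule nn_integral_count_space_nat)
  also have "\<dots> = ennreal (exp (r * g) * exp (- r))"
    using sums assms by (intro suminf_ennreal_eq) auto
  also have "exp (r * g) * exp (- r) = exp (- r * (1 - g))"
    by (simp add: exp_add[symmetric] algebra_simps)
  finally show ?thesis .
qed

fun kernel_power :: "('a \<Rightarrow> 'a pmf) \<Rightarrow> nat \<Rightarrow> 'a \<Rightarrow> 'a pmf" where
  "kernel_power K 0 x = return_pmf x"
| "kernel_power K (Suc n) x = bind_pmf (K x) (kernel_power K n)"

lemma kernel_power_add: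
  "kernel_power K (i + j) x = bind_pmf (kernel_power K i x) (kernel_power K j)"
  by (induction i arbitrary: x) (simp_all add: bind_return_pmf bind_assoc_pmf cong: bind_pmf_cong)

text \<open>The semigroup \<open>exp (t * L * (K - I))\<close>: the discrete chain \<open>K\<close>
  run at the jumps of a Poisson process of rate \<open>L\<close>.\<close>

definition poissonized :: "real \<Rightarrow> ('a \<Rightarrow> 'a pmf) \<Rightarrow> real \<Rightarrow> 'a \<Rightarrow> 'a pmf" where
  "poissonized L K t x = bind_pmf (poisson_count (L * t)) (\<lambda>n. kernel_power K n x)"

lemma poissonized_0: "poissonized L K 0 x = return_pmf x"
  by (simp add: poissonized_def poisson_count_def bind_return_pmf)

lemma poissonized_add:
  assumes "0 \<le> L" "0 \<le> s" "0 \<le> t"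
  shows "poissonized L K (s + t) x = bind_pmf (poissonized L K s x) (poissonized L K t)"
proof -
  have "poissonized L K (s + t) x = bind_pmf (poisson_count (L * s)) (\<lambda>i.
      bind_pmf (poisson_count (L * t)) (\<lambda>j. bind_pmf (kernel_power K i x) (kernel_power K j)))"
    using assms
    by (simp add: poissonized_def distrib_left poisson_count_add bind_assoc_pmf bind_return_pmf kernel_power_add)
  also have "\<dots> = bind_pmf (poisson_count (L * s)) (\<lambda>i. bind_pmf (kernel_power K i x) (\<lambda>z.
      bind_pmf (poisson_count (L * t)) (\<lambda>j. kernel_power K j z)))"
    by (subst bind_commute_pmf) (rule refl)
  finally show ?thesis by (simp add: poissonized_def[abs_def] bind_assoc_pmf)
qed

lemma poissonized_deriv:
  assumes "0 < L"
  shows "((\<lambda>h. (pmf (poissonized L K h x) y - of_bool (x = y)) / h)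
      \<longlongrightarrow> L * (pmf (K x) y - of_bool (x = y))) (at_right 0)"
proof -
  \<comment> \<open>\<open>A h\<close> collects the events of zero or one jump, and
    \<open>R h\<close> is the probability of at least two jumps, which is of smaller order than
    \<open>h\<close>.\<close>
  define A where "A h = exp (- (L * h)) * of_bool (x = y) + L * h * exp (- (L * h)) * pmf (K x) y" for h
  define R where "R h = 1 - exp (- (L * h)) - L * h * exp (- (L * h))" for h
  have bound: "\<bar>pmf (poissonized L K h x) y - A h\<bar> \<le> R h" if "0 < h" for h
  proof -
    let ?p = "poisson_count (L * h)"
    let ?f = "\<lambda>n. pmf (kernel_power K n x) y"
    have pos: "0 \<le> L * h" using that assms by simp
    have "pmf (poissonized L K h x) y = measure_pmf.expectation ?p ?f"
      by (simp add: poissonized_def pmf_bind)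
    also have "\<dots> = measure_pmf.expectation ?p (\<lambda>n. indicator {0, 1} n * ?f n)
        + measure_pmf.expectation ?p (\<lambda>n. indicator (- {0, 1}) n * ?f n)"
      by (subst Bochner_Integration.integral_add[symmetric])
         (auto intro!: measure_pmf.integrable_const_bound[where B = 1] Bochner_Integration.integral_cong
            simp: indicator_def pmf_le_1)
    also have "measure_pmf.expectation ?p (\<lambda>n. indicator {0, 1} n * ?f n) = A h"
    proof -
      have "kernel_power K 0 = return_pmf" by (simp add: fun_eq_iff)
      then have "?f 1 = pmf (K x) y" by (simp add: bind_return_pmf')
      moreover have "?f 0 = of_bool (x = y)" by (simp add: indicator_def)
      moreover have "measure_pmf.expectation ?p (\<lambda>n. indicator {0, 1} n * ?f n) = pmf ?p 0 * ?f 0 + pmf ?p 1 * ?f 1"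
        by (subst integral_measure_pmf[of "{0, 1}"]) (auto simp: indicator_def split: if_splits)
      ultimately show ?thesis
        using pos by (simp only: A_def pmf_poisson_count) (simp add: mult_ac)
    qed
    finally have eq: "pmf (poissonized L K h x) y - A h
        = measure_pmf.expectation ?p (\<lambda>n. indicator (- {0, 1}) n * ?f n)" by simp
    have "measure_pmf.expectation ?p (\<lambda>n. indicator (- {0, 1}) n * ?f n)
        \<le> measure_pmf.expectation ?p (indicator (- {0, 1}))"
      by (intro integral_mono measure_pmf.integrable_const_bound[where B = 1])
         (auto simp: indicator_def pmf_le_1)
    also have "\<dots> = R h"
    proof -
      have "measure_pmf.prob ?p (- {0, 1}) = 1 - measure_pmf.prob ?p {0, 1}"
        using measure_pmf.prob_compl[of "{0, 1}" ?p] by (simp add: Compl_eq_Diff_UNIV)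
      also have "measure_pmf.prob ?p {0, 1} = pmf ?p 0 + pmf ?p 1"
        by (simp add: measure_measure_pmf_finite)
      finally show ?thesis
        by (simp only: pmf_poisson_count[OF pos] R_def) simp
    qed
    finally show ?thesis by (simp add: eq integral_nonneg)
  qed
  have "((\<lambda>h. (exp (- (L * h)) - 1) / h) \<longlongrightarrow> - L) (at_right 0)"
  proof -
    have "((\<lambda>h. exp (- (L * h))) has_real_derivative - L) (at 0)"
      by (auto intro!: derivative_eq_intros)
    then show ?thesis by (simp add: DERIV_def filterlim_at_split)
  qed
  note e = this
  have c: "((\<lambda>h::real. exp (- (L * h))) \<longlongrightarrow> exp (- (L * 0))) (at_right 0)"
    by (intro tendsto_intros)
  have "((\<lambda>h. - ((exp (- (L * h)) - 1) / h) - L * exp (- (L * h))) \<longlongrightarrow> - (- L) - L * exp (- (L * 0))) (at_right 0)"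
    by (intro tendsto_intros e c)
  then have "((\<lambda>h. - ((exp (- (L * h)) - 1) / h) - L * exp (- (L * h))) \<longlongrightarrow> 0) (at_right 0)" by simp
  then have R: "((\<lambda>h. R h / h) \<longlongrightarrow> 0) (at_right 0)"
    by (rule Lim_transform_eventually)
       (use eventually_at_right_less[of 0] in \<open>eventually_elim, simp add: R_def diff_divide_distrib\<close>)
  have "((\<lambda>h. (exp (- (L * h)) - 1) / h * of_bool (x = y) + L * exp (- (L * h)) * pmf (K x) y)
      \<longlongrightarrow> - L * of_bool (x = y) + L * exp (- (L * 0)) * pmf (K x) y) (at_right 0)"
    by (intro tendsto_intros e c)
  then have "((\<lambda>h. (exp (- (L * h)) - 1) / h * of_bool (x = y) + L * exp (- (L * h)) * pmf (K x) y)
      \<longlongrightarrow> L * (pmf (K x) y - of_bool (x = y))) (at_right 0)"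
    by (simp add: algebra_simps)
  then have A: "((\<lambda>h. (A h - of_bool (x = y)) / h) \<longlongrightarrow> L * (pmf (K x) y - of_bool (x = y))) (at_right 0)"
    by (rule Lim_transform_eventually)
       (use eventually_at_right_less[of 0] in
         \<open>eventually_elim, simp add: A_def diff_divide_distrib add_divide_distrib left_diff_distrib\<close>)
  have "((\<lambda>h. (pmf (poissonized L K h x) y - A h) / h) \<longlongrightarrow> 0) (at_right 0)"
    by (rule Lim_null_comparison[OF _ R])
       (use bound in \<open>auto simp: eventually_at_right_field divide_right_mono intro!: exI[of _ 1]\<close>)
  from tendsto_add[OF this A] show ?thesis
    by (simp add: add_divide_distrib[symmetric])
qed

text \<open>The constant \<open>b / (1 - g)\<close> is the fixed point of
  \<open>v \<mapsto> g * v + b\<close>, so the bound reproduces itself under one more step.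
  Nonnegative integrals are used because \<open>W\<close> may be unbounded.\<close>

lemma kernel_power_drift:
  fixes K :: "'a \<Rightarrow> 'a pmf"
  assumes drift: "\<And>x. (\<integral>\<^sup>+y. ennreal (W y) \<partial>K x) \<le> ennreal (g * W x + b)"
    and W: "\<And>x. 0 \<le> W x" and g: "0 \<le> g" "g < 1" and b: "0 \<le> b"
  shows "(\<integral>\<^sup>+y. ennreal (W y) \<partial>kernel_power K n x) \<le> ennreal (g ^ n * W x + b / (1 - g))"
proof (induction n)
  case 0
  show ?case using assms by (auto intro!: ennreal_leI)
next
  case (Suc n)
  \<comment> \<open>\<open>kernel_power\<close> is defined by splitting off the first step; the
    drift is applied to the last one.\<close>
  have "kernel_power K (Suc n) x = bind_pmf (kernel_power K n x) K"
    using kernel_power_add[of K n 1 x] by (simp add: bind_return_pmf' cong: bind_pmf_cong)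
  then have "(\<integral>\<^sup>+y. ennreal (W y) \<partial>kernel_power K (Suc n) x)
      \<le> (\<integral>\<^sup>+z. ennreal g * ennreal (W z) + ennreal b \<partial>kernel_power K n x)"
    using drift W g b by (auto intro!: nn_integral_mono simp: ennreal_mult[symmetric] ennreal_plus[symmetric] simp del: ennreal_plus)
  also have "\<dots> = ennreal g * (\<integral>\<^sup>+z. ennreal (W z) \<partial>kernel_power K n x) + ennreal b"
    by (simp add: nn_integral_add nn_integral_cmult)
  also have "\<dots> \<le> ennreal g * ennreal (g ^ n * W x + b / (1 - g)) + ennreal b"
    by (intro add_right_mono mult_left_mono Suc) auto
  also have "\<dots> = ennreal (g * (g ^ n * W x + b / (1 - g)) + b)"
    using W g b by (subst ennreal_mult[symmetric]) (auto simp: ennreal_plus[symmetric] simp del: ennreal_plus)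
  also have "g * (g ^ n * W x + b / (1 - g)) + b = g ^ Suc n * W x + b / (1 - g)"
    using g by (simp add: field_simps)
  finally show ?case .
qed

lemma poissonized_drift:
  fixes K :: "'a \<Rightarrow> 'a pmf"
  assumes drift: "\<And>x. (\<integral>\<^sup>+y. ennreal (W y) \<partial>K x) \<le> ennreal (g * W x + b)"
    and W: "\<And>x. 0 \<le> W x" and g: "0 \<le> g" "g < 1" and b: "0 \<le> b" and "0 \<le> L" "0 \<le> t"
  shows "(\<integral>\<^sup>+y. ennreal (W y) \<partial>poissonized L K t x)
      \<le> ennreal (exp (- (L * (1 - g)) * t) * W x + b / (1 - g))"
proof -
  have "(\<integral>\<^sup>+y. ennreal (W y) \<partial>poissonized L K t x)
      \<le> (\<integral>\<^sup>+n. ennreal (g ^ n) * ennreal (W x) + ennreal (b / (1 - g)) \<partial>poisson_count (L * t))"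
    unfolding poissonized_def nn_integral_bind_pmf
    using W g b kernel_power_drift[OF drift W g b]
    by (intro nn_integral_mono)
       (simp add: ennreal_mult[symmetric] ennreal_plus[symmetric] del: ennreal_plus)
  also have "\<dots> = ennreal (exp (- (L * t) * (1 - g))) * ennreal (W x) + ennreal (b / (1 - g))"
    using nn_integral_poisson_count_power[of "L * t" g] assms
    by (simp add: nn_integral_add nn_integral_multc)
  also have "\<dots> = ennreal (exp (- (L * (1 - g)) * t) * W x + b / (1 - g))"
    using W g b by (simp add: ennreal_mult[symmetric] ennreal_plus[symmetric] mult_ac del: ennreal_plus)
  finally show ?thesis .
qed

lemma set_pmf_poissonized:
  assumes "0 < L" "0 < t"
  shows "set_pmf (poissonized L K t x) = (\<Union>n. set_pmf (kernel_power K n x))"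
  using assms by (simp add: poissonized_def poisson_count_def)

section \<open>The uniformized chain of a bounded generator\<close>

context bounded_generator
begin

definition uniformized :: "'a \<Rightarrow> 'a pmf" where
  "uniformized x = embed_pmf (\<lambda>y. of_bool (x = y) + G x y / L)"

lemma pmf_uniformized: "pmf (uniformized x) y = of_bool (x = y) + G x y / L"
  unfolding uniformized_def
proof (rule pmf_embed_pmf)
  let ?f = "\<lambda>y. of_bool (x = y) + G x y / L"
  show nonneg: "0 \<le> ?f y" for y
    using rate_less[of x] nonneg_off_diag[of x y] rate_bound_pos
    by (cases "x = y") (auto simp: field_simps)
  have delta: "(\<Sum>y\<in>N x. of_bool (x = y) :: real) = 1"
    using finite_nbrs self_nbr by (subst sum.remove[where x = x]) (auto intro: sum.neutral)
  have "(\<integral>\<^sup>+y. ennreal (?f y) \<partial>count_space UNIV) = (\<Sum>y\<in>N x. ennreal (?f y))"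
    using finite_nbrs self_nbr zero_off_nbrs by (intro nn_integral_count_space') auto
  also have "\<dots> = ennreal (\<Sum>y\<in>N x. ?f y)" by (rule sum_ennreal) (rule nonneg)
  also have "(\<Sum>y\<in>N x. ?f y) = 1"
    by (simp add: sum.distrib delta sum_divide_distrib[symmetric] row_sum)
  finally show "(\<integral>\<^sup>+y. ennreal (?f y) \<partial>count_space UNIV) = 1" by simp
qed

lemma set_pmf_uniformized: "set_pmf (uniformized x) \<subseteq> N x"
proof
  fix y assume "y \<in> set_pmf (uniformized x)"
  then show "y \<in> N x"
    using zero_off_nbrs[of y x] self_nbr[of x] by (cases "x = y") (auto simp: set_pmf_iff pmf_uniformized)
qed

lemma nn_integral_uniformized:
  assumes "\<And>x. 0 \<le> f x"
  shows "(\<integral>\<^sup>+y. ennreal (f y) \<partial>uniformized x) = ennreal (f x + gen f x / L)"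
proof -
  have "(\<integral>\<^sup>+y. ennreal (f y) \<partial>uniformized x) = (\<Sum>y\<in>N x. ennreal (f y) * ennreal (pmf (uniformized x) y))"
    using set_pmf_uniformized finite_nbrs
    by (intro nn_integral_measure_pmf_support) auto
  also have "\<dots> = ennreal (\<Sum>y\<in>N x. f y * pmf (uniformized x) y)"
    using assms by (simp add: ennreal_mult[symmetric] sum_ennreal)
  also have "(\<Sum>y\<in>N x. f y * pmf (uniformized x) y) = (\<Sum>y\<in>N x. f y * of_bool (x = y)) + gen f x / L"
    by (simp add: pmf_uniformized gen_def distrib_left sum.distrib sum_divide_distrib mult_ac)
  also have "(\<Sum>y\<in>N x. f y * of_bool (x = y)) = f x"
    using finite_nbrs self_nbr by (subst sum.remove[where x = x]) (auto intro: sum.neutral)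
  finally show ?thesis .
qed

lemma transition_semigroup_poissonized:
  "transition_semigroup G (poissonized L uniformized)"
  unfolding transition_semigroup_def
proof (intro conjI allI impI)
  show "((\<lambda>h. (pmf (poissonized L uniformized h x) y - of_bool (x = y)) / h) \<longlongrightarrow> G x y) (at_right 0)" for x y
    using poissonized_deriv[OF rate_bound_pos, of uniformized x y] rate_bound_pos
    by (simp add: pmf_uniformized)
qed (simp_all add: poissonized_0 poissonized_add less_imp_le[OF rate_bound_pos])

text \<open>A path of positive rates is a path of the uniformized chain, and for
  \<open>t > 0\<close> the Poisson clock makes any number of jumps with positive probability. Hence
  any positive time suffices, in particular the unit time used for the atom below.\<close>

lemma reachable_poissonized:
  assumes "(x, y) \<in> {(a, b). 0 < G a b}\<^sup>*" "0 < t"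
  shows "y \<in> set_pmf (poissonized L uniformized t x)"
proof -
  have "\<exists>n. y \<in> set_pmf (kernel_power uniformized n x)"
    using assms(1)
  proof (induction rule: converse_rtrancl_induct)
    case base
    show ?case by (rule exI[of _ 0]) simp
  next
    case (step a b)
    then obtain n where "y \<in> set_pmf (kernel_power uniformized n b)" by blast
    moreover have "b \<in> set_pmf (uniformized a)"
      using step.hyps(1) rate_bound_pos by (auto simp: set_pmf_iff pmf_uniformized add_nonneg_eq_0_iff)
    ultimately show ?case by (intro exI[of _ "Suc n"]) auto
  qed
  then show ?thesis by (simp add: set_pmf_poissonized[OF rate_bound_pos assms(2)])
qed

text \<open>A generator drift \<open>- k * W + b\<close> is a one-step drift of the uniformized
  chain with factor \<open>1 - k / L\<close> and constant \<open>b / L\<close>; the bound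
  \<open>k \<le> L\<close> keeps the factor nonnegative.\<close>

lemma poissonized_uniformized_drift:
  assumes drift: "\<And>x. gen W x \<le> - k * W x + b"
    and W: "\<And>x. 0 \<le> W x" and k: "0 < k" "k \<le> L" and b: "0 \<le> b" and "0 \<le> t"
  shows "(\<integral>\<^sup>+y. ennreal (W y) \<partial>poissonized L uniformized t x) \<le> ennreal (exp (- k * t) * W x + b / k)"
proof -
  have "(\<integral>\<^sup>+y. ennreal (W y) \<partial>uniformized x) \<le> ennreal ((1 - k / L) * W x + b / L)" for x
  proof -
    have "gen W x / L \<le> (- k * W x + b) / L"
      using drift rate_bound_pos by (intro divide_right_mono) auto
    then show ?thesis
      unfolding nn_integral_uniformized[OF W] by (intro ennreal_leI) (simp add: algebra_simps diff_divide_distrib)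
  qed
  from poissonized_drift[OF this W, of L t x] show ?thesis
    using k b \<open>0 \<le> t\<close> rate_bound_pos by simp
qed

end

section \<open>Harris' theorem\<close>

text \<open>Under the product coupling both copies sit at the atom \<open>z\<close> with probability at least
  \<open>\<alpha>\<^sup>2\<close>, and then contribute nothing.\<close>

lemma product_coupling_bound:
  fixes f W :: "'a \<Rightarrow> real"
  assumes f: "\<And>x. \<bar>f x\<bar> \<le> B" and W: "\<And>x. 0 \<le> W x"
    and intW: "integrable (measure_pmf p) W" "integrable (measure_pmf q) W"
    and osc: "\<And>x y. \<bar>f x - f y\<bar> \<le> M * (2 + \<beta> * (W x + W y))"
    and nonneg: "0 \<le> M" "0 \<le> \<beta>" "0 \<le> \<alpha>"
    and atom: "\<alpha> \<le> pmf p z" "\<alpha> \<le> pmf q z"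
  shows "\<bar>measure_pmf.expectation p f - measure_pmf.expectation q f\<bar>
    \<le> M * (2 * (1 - \<alpha>\<^sup>2) + \<beta> * (measure_pmf.expectation p W + measure_pmf.expectation q W))"
proof -
  let ?r = "pair_pmf p q"
  have int_fst: "integrable (measure_pmf ?r) (\<lambda>s. g (fst s))" if "integrable (measure_pmf p) g" for g :: "'a \<Rightarrow> real"
    using that integrable_map_pmf_eq[of fst ?r g] by (simp add: map_fst_pair_pmf)
  have int_snd: "integrable (measure_pmf ?r) (\<lambda>s. g (snd s))" if "integrable (measure_pmf q) g" for g :: "'a \<Rightarrow> real"
    using that integrable_map_pmf_eq[of snd ?r g] by (simp add: map_snd_pair_pmf)
  have intf: "integrable (measure_pmf t) f" for t :: "'a pmf"
    using f by (intro measure_pmf.integrable_const_bound[where B = B]) auto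
  have int_ind: "integrable (measure_pmf ?r) (\<lambda>s. 1 - indicator {(z, z)} s :: real)"
    by (intro measure_pmf.integrable_const_bound[where B = 1]) (auto simp: indicator_def)
  note ints = int_fst[OF intf] int_snd[OF intf] int_fst[OF intW(1)] int_snd[OF intW(2)] int_ind
  have "measure_pmf.expectation p f - measure_pmf.expectation q f
      = measure_pmf.expectation ?r (\<lambda>s. f (fst s) - f (snd s))"
    using ints by simp
  also have "\<bar>\<dots>\<bar> \<le> measure_pmf.expectation ?r (\<lambda>s. \<bar>f (fst s) - f (snd s)\<bar>)"
    by (rule integral_abs_bound)
  also have "\<dots> \<le> measure_pmf.expectation ?r
      (\<lambda>s. M * (2 * (1 - indicator {(z, z)} s) + \<beta> * (W (fst s) + W (snd s))))"
  proof (intro integral_mono)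
    show "integrable (measure_pmf ?r) (\<lambda>s. \<bar>f (fst s) - f (snd s)\<bar>)"
      by (intro integrable_abs Bochner_Integration.integrable_diff ints)
    show "integrable (measure_pmf ?r)
        (\<lambda>s. M * (2 * (1 - indicator {(z, z)} s) + \<beta> * (W (fst s) + W (snd s))))"
      by (intro integrable_mult_right Bochner_Integration.integrable_add ints)
    show "\<bar>f (fst s) - f (snd s)\<bar> \<le> M * (2 * (1 - indicator {(z, z)} s) + \<beta> * (W (fst s) + W (snd s)))" for s
      using osc[of "fst s" "snd s"] W nonneg by (cases "s = (z, z)") auto
  qed
  also have "\<dots> = M * (2 * (1 - pmf p z * pmf q z)
      + \<beta> * (measure_pmf.expectation p W + measure_pmf.expectation q W))"
  proof -
    have "measure_pmf.expectation ?r (\<lambda>s. 1 - indicator {(z, z)} s) = 1 - pmf p z * pmf q z"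
      by (subst Bochner_Integration.integral_diff)
         (auto simp: measure_pmf_single pmf_pair intro: measure_pmf.integrable_const_bound[where B = 1])
    then show ?thesis
      by (simp only: integral_mult_right_zero Bochner_Integration.integral_add integrable_mult_right
          Bochner_Integration.integrable_add ints expectation_pair_pmf_fst expectation_pair_pmf_snd)
  qed
  also have "\<dots> \<le> M * (2 * (1 - \<alpha>\<^sup>2) + \<beta> * (measure_pmf.expectation p W + measure_pmf.expectation q W))"
    using nonneg atom by (intro mult_left_mono add_right_mono) (auto simp: power2_eq_square intro: mult_mono)
  finally show ?thesis .
qed

text \<open>The contraction step of Harris' theorem, in the weighted oscillation seminorm of Hairer
  and Mattingly.\<close>

lemma harris_contraction:
  fixes K :: "'a \<Rightarrow> 'a pmf" and W :: "'a \<Rightarrow> real"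
  assumes W: "\<And>x. 0 \<le> W x"
    and intW: "\<And>x. integrable (measure_pmf (K x)) W"
    and drift: "\<And>x. measure_pmf.expectation (K x) W \<le> g * W x + b"
    and g: "0 \<le> g" "g < 1" and b: "0 < b"
    and small: "\<And>R. finite {x. W x \<le> R}"
    and atom: "\<And>x. z \<in> set_pmf (K x)"
  obtains \<rho> \<beta> where "0 \<le> \<rho>" "\<rho> < 1" "0 \<le> \<beta>"
    "\<And>f B M x y. (\<And>x. \<bar>f x\<bar> \<le> B) \<Longrightarrow> 0 \<le> M \<Longrightarrow> (\<And>x y. \<bar>f x - f y\<bar> \<le> M * (2 + \<beta> * (W x + W y))) \<Longrightarrow>
       \<bar>measure_pmf.expectation (K x) f - measure_pmf.expectation (K y) f\<bar> \<le> M * \<rho> * (2 + \<beta> * (W x + W y))"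
proof -
  \<comment> \<open>Chosen so that \<open>2 * b = (1 - g) / 2 * R\<close>: beyond level
    \<open>R\<close>, half of the gap \<open>1 - g\<close> pays for the additive drift, and the
    factor \<open>g'\<close> remains.\<close>
  define R where "R = 4 * b / (1 - g)"
  have R: "0 < R" using g b by (simp add: R_def)
  \<comment> \<open>The sublevel set is finite, so the atom has a uniform positive mass on it;
    inserting 1 keeps the minimum defined when the set is empty.\<close>
  define \<alpha> where "\<alpha> = Min (insert 1 ((\<lambda>x. pmf (K x) z) ` {x. W x \<le> R}))"
  have \<alpha>: "0 < \<alpha>" "\<alpha> \<le> 1" using atom small[of R] by (auto simp: \<alpha>_def pmf_positive)
  have \<alpha>_le: "\<alpha> \<le> pmf (K x) z" if "W x \<le> R" for x
    unfolding \<alpha>_def using small[of R] that by (intro Min_le) auto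
  have \<alpha>2: "0 < \<alpha>\<^sup>2" using \<alpha> by simp
  \<comment> \<open>With this weight the additive drift costs
    \<open>\<beta> * (2 * b) = \<alpha>\<^sup>2\<close>, half of the gain
    \<open>2 * \<alpha>\<^sup>2\<close> from the coupling.\<close>
  define \<beta> where "\<beta> = \<alpha>\<^sup>2 / (2 * b)"
  have \<beta>: "0 < \<beta>" using \<alpha>2 b by (simp add: \<beta>_def)
  define g' where "g' = (1 + g) / 2"
  have g': "g \<le> g'" "g' < 1" "0 \<le> g'" using g by (auto simp: g'_def)
  \<comment> \<open>The ratio \<open>(2 + \<beta> * g' * s) / (2 + \<beta> * s)\<close> decreases in
    \<open>s\<close>; this is its value at \<open>s = R\<close>.\<close>
  define \<rho>1 where "\<rho>1 = (2 + \<beta> * g' * R) / (2 + \<beta> * R)"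
  define \<rho> where "\<rho> = Max {\<rho>1, 1 - \<alpha>\<^sup>2 / 2, g}"
  have den: "0 < 2 + \<beta> * R" using \<beta> R by (simp add: add_pos_pos)
  have \<rho>1: "\<rho>1 < 1" "g' \<le> \<rho>1"
  proof -
    have "\<beta> * R * g' < \<beta> * R * 1" using \<beta> R g' by (intro mult_strict_left_mono) auto
    then show "\<rho>1 < 1" using den by (simp add: \<rho>1_def mult_ac)
    show "g' \<le> \<rho>1" using den g' by (simp add: \<rho>1_def pos_le_divide_eq algebra_simps)
  qed
  have ge: "\<rho>1 \<le> \<rho>" "1 - \<alpha>\<^sup>2 / 2 \<le> \<rho>" "g \<le> \<rho>" by (auto simp: \<rho>_def)
  have lt: "\<rho> < 1" using \<rho>1 \<alpha>2 g by (auto simp: \<rho>_def)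
  have main: "\<bar>measure_pmf.expectation (K x) f - measure_pmf.expectation (K y) f\<bar> \<le> M * \<rho> * (2 + \<beta> * (W x + W y))"
    if f: "\<And>x. \<bar>f x\<bar> \<le> B" and M: "0 \<le> M" and osc: "\<And>x y. \<bar>f x - f y\<bar> \<le> M * (2 + \<beta> * (W x + W y))"
    for f B M x y
  proof -
    define s where "s = W x + W y"
    have s: "0 \<le> s" using W by (simp add: s_def)
    have EW: "measure_pmf.expectation (K x) W + measure_pmf.expectation (K y) W \<le> g * s + 2 * b"
      using drift[of x] drift[of y] by (simp add: s_def algebra_simps)
    have est: "\<bar>measure_pmf.expectation (K x) f - measure_pmf.expectation (K y) f\<bar>
        \<le> M * (2 * (1 - a\<^sup>2) + \<beta> * (g * s + 2 * b))"
      if "0 \<le> a" "a \<le> pmf (K x) z" "a \<le> pmf (K y) z" for a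
    proof -
      have "\<bar>measure_pmf.expectation (K x) f - measure_pmf.expectation (K y) f\<bar>
        \<le> M * (2 * (1 - a\<^sup>2) + \<beta> * (measure_pmf.expectation (K x) W + measure_pmf.expectation (K y) W))"
        using \<beta> by (intro product_coupling_bound[where B = B and z = z] f W intW osc M that) auto
      also have "\<dots> \<le> M * (2 * (1 - a\<^sup>2) + \<beta> * (g * s + 2 * b))"
        using EW M \<beta> by (intro mult_left_mono add_left_mono) auto
      finally show ?thesis .
    qed
    have "\<exists>a. 0 \<le> a \<and> a \<le> pmf (K x) z \<and> a \<le> pmf (K y) z \<and>
        2 * (1 - a\<^sup>2) + \<beta> * (g * s + 2 * b) \<le> \<rho> * (2 + \<beta> * s)"
    \<comment> \<open>Far out the drift alone contracts, so \<open>a = 0\<close>. Otherwise both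
      points lie in the sublevel set and the atom contributes with
      \<open>a = \<alpha>\<close>.\<close>
    proof (cases "R \<le> s")
      case True
      have "2 * b = (1 - g) / 2 * R" using g by (simp add: R_def)
      also have "\<dots> \<le> (1 - g) / 2 * s" using True g by (intro mult_left_mono) auto
      finally have "g * s + 2 * b \<le> g' * s" by (simp add: g'_def field_simps)
      then have "\<beta> * (g * s + 2 * b) \<le> \<beta> * (g' * s)" using \<beta> by simp
      moreover have "2 + \<beta> * (g' * s) \<le> \<rho>1 * (2 + \<beta> * s)"
      proof -
        have "(2 + \<beta> * R) * \<rho>1 = 2 + \<beta> * g' * R" using den by (simp add: \<rho>1_def)
        moreover have "0 \<le> (\<rho>1 - g') * (\<beta> * (s - R))" using \<rho>1 \<beta> True by simp
        ultimately show ?thesis by (simp add: algebra_simps)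
      qed
      moreover have "\<rho>1 * (2 + \<beta> * s) \<le> \<rho> * (2 + \<beta> * s)"
        using ge \<beta> s by (intro mult_right_mono) auto
      ultimately show ?thesis by (intro exI[of _ 0]) auto
    next
      case False
      then have "W x \<le> R" "W y \<le> R" using W[of x] W[of y] by (auto simp: s_def)
      moreover have "2 * (1 - \<alpha>\<^sup>2) + \<beta> * (g * s + 2 * b) \<le> \<rho> * (2 + \<beta> * s)"
      proof -
        have "\<beta> * (2 * b) = \<alpha>\<^sup>2" using b by (simp add: \<beta>_def)
        then have "2 * (1 - \<alpha>\<^sup>2) + \<beta> * (g * s + 2 * b) = 2 * (1 - \<alpha>\<^sup>2 / 2) + g * (\<beta> * s)"
          by (simp add: algebra_simps)
        also have "\<dots> \<le> 2 * \<rho> + \<rho> * (\<beta> * s)"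
          using ge \<beta> s by (intro add_mono mult_right_mono) auto
        finally show ?thesis by (simp add: algebra_simps)
      qed
      ultimately show ?thesis using \<alpha>_le \<alpha> by (intro exI[of _ \<alpha>]) auto
    qed
    then obtain a where a: "0 \<le> a" "a \<le> pmf (K x) z" "a \<le> pmf (K y) z"
      "2 * (1 - a\<^sup>2) + \<beta> * (g * s + 2 * b) \<le> \<rho> * (2 + \<beta> * s)" by blast
    have "\<bar>measure_pmf.expectation (K x) f - measure_pmf.expectation (K y) f\<bar> \<le> M * (\<rho> * (2 + \<beta> * s))"
      using est[OF a(1-3)] mult_left_mono[OF a(4) M] by linarith
    then show ?thesis by (simp add: s_def mult.assoc)
  qed
  show ?thesis
  proof (rule that[of \<rho> \<beta>])
    show "0 \<le> \<rho>" using ge g by simp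
    show "0 \<le> \<beta>" using \<beta> by simp
  qed (fact lt, rule main)
qed

section \<open>Limits of probability mass functions and convergence to the steady state\<close>

lemma expectation_le_of_nn_integral:
  fixes f :: "'a \<Rightarrow> real"
  assumes "\<And>x. 0 \<le> f x" "(\<integral>\<^sup>+x. ennreal (f x) \<partial>measure_pmf p) \<le> ennreal c" "0 \<le> c"
  shows "integrable (measure_pmf p) f" "measure_pmf.expectation p f \<le> c"
proof -
  show int: "integrable (measure_pmf p) f"
    using assms by (intro integrableI_nonneg) (auto intro: le_less_trans)
  have "ennreal (measure_pmf.expectation p f) \<le> ennreal c"
    using nn_integral_eq_integral[OF int] assms by simp
  then show "measure_pmf.expectation p f \<le> c" using assms by simp
qed

text \<open>Pointwise limits may lose mass but cannot gain any, by Fatou. Markov's inequality leaves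
  mass at least \<open>1 - C / R\<close> on the finite set where \<open>W \<le> R\<close>, and on
  finite sets masses converge; then \<open>R\<close> grows.\<close>

lemma pmf_limit_exists:
  fixes p :: "nat \<Rightarrow> 'a pmf" and W :: "'a \<Rightarrow> real"
  assumes lim: "\<And>y. (\<lambda>n. pmf (p n) y) \<longlonglongrightarrow> l y"
    and W: "\<And>x. 0 \<le> W x" and small: "\<And>R. finite {x. W x \<le> R}"
    and tight: "\<And>n. (\<integral>\<^sup>+y. ennreal (W y) \<partial>p n) \<le> ennreal C" and C: "0 \<le> C"
  obtains q where "\<And>y. pmf q y = l y"
proof -
  have l: "0 \<le> l y" for y using lim by (rule LIMSEQ_le_const) auto
  have elim: "(\<lambda>n. ennreal (pmf (p n) y)) \<longlonglongrightarrow> ennreal (l y)" for y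
    using lim by simp
  have "(\<integral>\<^sup>+y. ennreal (l y) \<partial>count_space UNIV)
      = (\<integral>\<^sup>+y. liminf (\<lambda>n. ennreal (pmf (p n) y)) \<partial>count_space UNIV)"
    using lim_imp_Liminf[OF _ elim] by (intro nn_integral_cong) auto
  also have "\<dots> \<le> liminf (\<lambda>n. \<integral>\<^sup>+y. ennreal (pmf (p n) y) \<partial>count_space UNIV)"
    by (intro nn_integral_liminf) auto
  also have "\<dots> = 1" by (simp add: nn_integral_pmf Liminf_const)
  finally have le: "(\<integral>\<^sup>+y. ennreal (l y) \<partial>count_space UNIV) \<le> 1" .
  have ge: "ennreal (1 - C / R) \<le> (\<integral>\<^sup>+y. ennreal (l y) \<partial>count_space UNIV)" if "0 < R" for R
  proof -
    let ?F = "{x. W x \<le> R}"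
    have "1 - C / R \<le> (\<Sum>y\<in>?F. pmf (p n) y)" for n
    proof -
      note EW = expectation_le_of_nn_integral[OF W tight C, of n]
      have "measure_pmf.expectation (p n) (indicator (- ?F)) \<le> measure_pmf.expectation (p n) (\<lambda>y. W y / R)"
      proof (rule integral_mono)
        show "integrable (measure_pmf (p n)) (indicator (- ?F) :: 'a \<Rightarrow> real)"
          by (intro measure_pmf.integrable_const_bound[where B = 1]) auto
      qed (use W that EW(1) in \<open>auto simp: indicator_def\<close>)
      also have "\<dots> \<le> C / R" using EW(2) that by (simp add: divide_right_mono)
      finally have "measure_pmf.prob (p n) (- ?F) \<le> C / R" by simp
      then show ?thesis
        using measure_pmf.prob_compl[of ?F "p n"] small[of R]
        by (simp add: Compl_eq_Diff_UNIV measure_measure_pmf_finite)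
    qed
    moreover have "(\<lambda>n. \<Sum>y\<in>?F. pmf (p n) y) \<longlonglongrightarrow> (\<Sum>y\<in>?F. l y)"
      by (intro tendsto_sum lim)
    ultimately have "1 - C / R \<le> (\<Sum>y\<in>?F. l y)"
      by (intro LIMSEQ_le_const) auto
    then have "ennreal (1 - C / R) \<le> (\<Sum>y\<in>?F. ennreal (l y))"
      using l by (simp add: sum_ennreal ennreal_leI)
    also have "\<dots> = (\<integral>\<^sup>+y. ennreal (l y) * indicator ?F y \<partial>count_space UNIV)"
      using small[of R] by (subst nn_integral_count_space'[of ?F]) auto
    also have "\<dots> \<le> (\<integral>\<^sup>+y. ennreal (l y) \<partial>count_space UNIV)"
      by (intro nn_integral_mono) (auto simp: indicator_def)
    finally show ?thesis .
  qed
  have "1 \<le> (\<integral>\<^sup>+y. ennreal (l y) \<partial>count_space UNIV)"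
  proof (rule LIMSEQ_le_const2)
    have "(\<lambda>n. 1 - C / real (Suc n)) \<longlonglongrightarrow> 1 - 0"
      by (intro tendsto_diff tendsto_const LIMSEQ_Suc[OF lim_const_over_n])
    then show "(\<lambda>n. ennreal (1 - C / real (Suc n))) \<longlonglongrightarrow> 1"
      using tendsto_ennrealI by fastforce
  qed (use ge in auto)
  with le have one: "(\<integral>\<^sup>+y. ennreal (l y) \<partial>count_space UNIV) = 1" by simp
  show ?thesis by (rule that[of "embed_pmf l"]) (rule pmf_embed_pmf[OF l one])
qed

lemma nn_integral_pmf_limit_le:
  fixes p :: "nat \<Rightarrow> 'a pmf"
  assumes "\<And>y. (\<lambda>n. pmf (p n) y) \<longlonglongrightarrow> pmf q y"
  shows "(\<integral>\<^sup>+y. f y \<partial>q) \<le> liminf (\<lambda>n. \<integral>\<^sup>+y. f y \<partial>p n)"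
proof -
  have "(\<integral>\<^sup>+y. f y \<partial>q) = (\<integral>\<^sup>+y. ennreal (pmf q y) * f y \<partial>count_space UNIV)"
    by (rule nn_integral_measure_pmf)
  also have "\<dots> \<le> (\<integral>\<^sup>+y. liminf (\<lambda>n. ennreal (pmf (p n) y) * f y) \<partial>count_space UNIV)"
  proof (intro nn_integral_mono)
    fix y
    show "ennreal (pmf q y) * f y \<le> liminf (\<lambda>n. ennreal (pmf (p n) y) * f y)"
    \<comment> \<open>Multiplication on the extended reals is discontinuous at
      \<open>0 * \<infinity>\<close>; where a factor of the limit vanishes, the claim is
      trivial.\<close>
    proof (cases "pmf q y = 0 \<or> f y = 0")
      case False
      then have "(\<lambda>n. ennreal (pmf (p n) y) * f y) \<longlonglongrightarrow> ennreal (pmf q y) * f y"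
        using assms[of y] by (intro tendsto_mult_ennreal tendsto_const) auto
      then show ?thesis by (simp add: lim_imp_Liminf)
    qed auto
  qed
  also have "\<dots> \<le> liminf (\<lambda>n. \<integral>\<^sup>+y. ennreal (pmf (p n) y) * f y \<partial>count_space UNIV)"
    by (intro nn_integral_liminf) auto
  finally show ?thesis by (simp add: nn_integral_measure_pmf)
qed

text \<open>The contraction is applied to the unit-time kernel \<open>P 1\<close>. It makes the
  dependence of \<open>pmf (P t x) y\<close> on \<open>x\<close> decay geometrically, which gives
  both convergence in \<open>t\<close> and a limit independent of \<open>x\<close>.\<close>

lemma harris_ergodic:
  fixes P :: "real \<Rightarrow> 'a \<Rightarrow> 'a pmf" and W :: "'a \<Rightarrow> real"
  assumes add: "\<And>s t x. 0 \<le> s \<Longrightarrow> 0 \<le> t \<Longrightarrow> P (s + t) x = bind_pmf (P s x) (P t)"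
    and W: "\<And>x. 0 \<le> W x"
    and drift: "\<And>t x. 0 \<le> t \<Longrightarrow> (\<integral>\<^sup>+y. ennreal (W y) \<partial>P t x) \<le> ennreal (exp (- k * t) * W x + c)"
    and k: "0 < k" and c: "0 \<le> c"
    and small: "\<And>R. finite {x. W x \<le> R}"
    and atom: "\<And>x. z \<in> set_pmf (P 1 x)"
  obtains p where "\<And>t. 0 \<le> t \<Longrightarrow> bind_pmf p (P t) = p"
    "\<And>x y. ((\<lambda>t. pmf (P t x) y) \<longlongrightarrow> pmf p y) at_top"
    "(\<integral>\<^sup>+y. ennreal (W y) \<partial>p) < \<infinity>"
proof -
  have bnd: "0 \<le> exp (- k * t) * W x + c" for t x using W c by simp
  note EW = expectation_le_of_nn_integral[OF W drift bnd]
  have le_W: "exp (- k * t) * W x + c \<le> W x + c" if "0 \<le> t" for t x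
    using mult_right_mono[of "exp (- k * t)" 1 "W x"] W k that by simp
  \<comment> \<open>The contraction lemma asks for a strictly positive drift constant, whence
    \<open>c + 1\<close>.\<close>
  have drift1: "measure_pmf.expectation (P 1 x) W \<le> exp (- k) * W x + (c + 1)" for x
    using EW(2)[of 1 x] by simp
  obtain \<rho> \<beta> where \<rho>: "0 \<le> \<rho>" "\<rho> < 1" and \<beta>: "0 \<le> \<beta>" and contr:
    "\<And>f B M x y. (\<And>x. \<bar>f x\<bar> \<le> B) \<Longrightarrow> 0 \<le> M \<Longrightarrow> (\<And>x y. \<bar>f x - f y\<bar> \<le> M * (2 + \<beta> * (W x + W y))) \<Longrightarrow>
       \<bar>measure_pmf.expectation (P 1 x) f - measure_pmf.expectation (P 1 y) f\<bar> \<le> M * \<rho> * (2 + \<beta> * (W x + W y))"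
    using harris_contraction[of W "P 1" "exp (- k)" "c + 1" z, OF W EW(1)[of 1] drift1 _ _ _ small atom] k c
    by (auto simp del: One_nat_def) blast
  \<comment> \<open>The remainder \<open>r\<close> covers non-integer times: each unit step is split
    off at the front, and \<open>P r\<close> stays as the final function.\<close>
  have osc: "\<bar>pmf (P (real n + r) x) y - pmf (P (real n + r) x') y\<bar> \<le> \<rho> ^ n * (2 + \<beta> * (W x + W x'))"
    if "0 \<le> r" for n r x x' y
  proof (induction n arbitrary: x x')
    case 0
    have "\<bar>pmf (P r x) y - pmf (P r x') y\<bar> \<le> 1"
      using pmf_le_1[of "P r x" y] pmf_le_1[of "P r x'" y] pmf_nonneg[of "P r x" y] pmf_nonneg[of "P r x'" y]
      by linarith
    moreover have "0 \<le> \<beta> * (W x + W x')" using \<beta> W by simp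
    ultimately show ?case by simp
  next
    case (Suc n)
    have "pmf (P (real (Suc n) + r) x) y = measure_pmf.expectation (P 1 x) (\<lambda>s. pmf (P (real n + r) s) y)" for x
      using add[of 1 "real n + r" x] that by (simp add: add_ac pmf_bind)
    then show ?case
      using contr[of "\<lambda>s. pmf (P (real n + r) s) y" 1 "\<rho> ^ n" x x'] Suc \<rho>
      by (simp add: pmf_le_1 mult_ac)
  qed
  define C where "C x = 2 + \<beta> * (2 * W x + c)" for x
  \<comment> \<open>Running for an extra time \<open>s\<close> at the beginning turns a time
    increment into an average oscillation over starting points. \<open>C x\<close> absorbs the mean
    of \<open>W\<close> at time \<open>s\<close>, which is at most \<open>W x + c\<close> for all
    \<open>s\<close>.\<close>
  have increment: "\<bar>pmf (P (real n + r + s) x) y - pmf (P (real n + r) x) y\<bar> \<le> \<rho> ^ n * C x"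
    if "0 \<le> r" "0 \<le> s" for n r s x y
  proof -
    let ?f = "\<lambda>w. pmf (P (real n + r) w) y"
    have intf: "integrable (measure_pmf (P s x)) ?f"
      by (intro measure_pmf.integrable_const_bound[where B = 1]) (auto simp: pmf_le_1)
    have intW: "integrable (measure_pmf (P s x)) W" by (rule EW(1)[OF that(2)])
    have "pmf (P (real n + r + s) x) y - ?f x = measure_pmf.expectation (P s x) (\<lambda>w. ?f w - ?f x)"
      using add[of s "real n + r" x] that intf by (simp add: add_ac pmf_bind)
    also have "\<bar>\<dots>\<bar> \<le> measure_pmf.expectation (P s x) (\<lambda>w. \<bar>?f w - ?f x\<bar>)"
      by (rule integral_abs_bound)
    also have "\<dots> \<le> measure_pmf.expectation (P s x) (\<lambda>w. \<rho> ^ n * (2 + \<beta> * (W w + W x)))"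
      using intf intW osc[OF that(1)]
      by (intro integral_mono) auto
    also have "\<dots> = \<rho> ^ n * (2 + \<beta> * (measure_pmf.expectation (P s x) W + W x))"
      using intW by simp
    also have "\<dots> \<le> \<rho> ^ n * C x"
      unfolding C_def using EW(2)[OF that(2), of x] le_W[OF that(2), of x] \<rho> \<beta>
      by (intro mult_left_mono add_left_mono) auto
    finally show ?thesis .
  qed
  have pow: "(\<lambda>n. \<rho> ^ n * C x) \<longlonglongrightarrow> 0" for x
    using \<rho> by (intro tendsto_mult_left_zero LIMSEQ_power_zero) auto
  have "\<exists>l. (\<lambda>n. pmf (P (real n) x) y) \<longlonglongrightarrow> l" for x y
  proof -
    have "Cauchy (\<lambda>n. pmf (P (real n) x) y)"
    proof (rule CauchyI')
      fix e :: real assume "0 < e"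
      then obtain M where M: "\<And>n. M \<le> n \<Longrightarrow> \<rho> ^ n * C x < e"
        using order_tendstoD(2)[OF pow[of x], of e] unfolding eventually_sequentially by blast
      have "dist (pmf (P (real m) x) y) (pmf (P (real n) x) y) < e" if "M \<le> m" "m < n" for m n
        using increment[of 0 "real n - real m" m x y] M[of m] that by (simp add: dist_real_def abs_minus_commute)
      then show "\<exists>M. \<forall>m\<ge>M. \<forall>n>m. dist (pmf (P (real m) x) y) (pmf (P (real n) x) y) < e" by blast
    qed
    then show ?thesis by (simp add: Cauchy_convergent_iff convergent_def)
  qed
  then obtain l where l: "\<And>x y. (\<lambda>n. pmf (P (real n) x) y) \<longlonglongrightarrow> l x y" by metis
  have const: "l x y = l z y" for x y
  proof -
    have "(\<lambda>n. pmf (P (real n) x) y - pmf (P (real n) z) y) \<longlonglongrightarrow> 0"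
    proof (rule Lim_null_comparison)
      show "\<forall>\<^sub>F n in sequentially. norm (pmf (P (real n) x) y - pmf (P (real n) z) y) \<le> \<rho> ^ n * (2 + \<beta> * (W x + W z))"
        using osc[of 0] by simp
      show "(\<lambda>n. \<rho> ^ n * (2 + \<beta> * (W x + W z))) \<longlonglongrightarrow> 0"
        using \<rho> by (intro tendsto_mult_left_zero LIMSEQ_power_zero) auto
    qed
    with tendsto_diff[OF l[of x y] l[of z y]] show ?thesis
      using LIMSEQ_unique by fastforce
  qed
  have tight: "(\<integral>\<^sup>+y. ennreal (W y) \<partial>P (real n) z) \<le> ennreal (W z + c)" for n
    using order_trans[OF drift ennreal_leI[OF le_W]] by simp
  have "0 \<le> W z + c" using W c by simp
  from pmf_limit_exists[of "\<lambda>n. P (real n) z", OF l W small tight this]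
  obtain p where p: "\<And>y. pmf p y = l z y" by blast
  have seq: "(\<lambda>n. pmf (P (real n) z) y) \<longlonglongrightarrow> pmf p y" for y
    using l by (simp add: p)
  have lim: "((\<lambda>t. pmf (P t x) y) \<longlongrightarrow> pmf p y) at_top" for x y
  proof -
    \<comment> \<open>The integer-time limit transfers to real \<open>t\<close> by comparing
      \<open>t\<close> with integers \<open>n \<ge> t\<close> and letting \<open>n\<close>
      grow.\<close>
    have bound: "\<bar>pmf (P t x) y - pmf p y\<bar> \<le> \<rho> ^ nat \<lfloor>t\<rfloor> * C x" if "0 \<le> t" for t
    proof -
      have t: "t = real (nat \<lfloor>t\<rfloor>) + frac t" using that by (simp add: frac_def)
      have "eventually (\<lambda>n. \<bar>pmf (P t x) y - pmf (P (real n) x) y\<bar> \<le> \<rho> ^ nat \<lfloor>t\<rfloor> * C x) sequentially"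
        using eventually_ge_at_top[of "nat \<lceil>t\<rceil>"]
      proof eventually_elim
        case (elim n)
        then have "t \<le> real n" by linarith
        then show ?case
          using increment[of "frac t" "real n - t" "nat \<lfloor>t\<rfloor>" x y] t by (simp add: abs_minus_commute)
      qed
      moreover have "(\<lambda>n. \<bar>pmf (P t x) y - pmf (P (real n) x) y\<bar>) \<longlonglongrightarrow> \<bar>pmf (P t x) y - pmf p y\<bar>"
        using l[of x y] by (intro tendsto_intros) (simp add: p const[of x y])
      ultimately show ?thesis
        by (intro tendsto_upperbound) auto
    qed
    have "((\<lambda>t. \<rho> ^ nat \<lfloor>t\<rfloor> * C x) \<longlongrightarrow> 0) at_top"
      by (rule filterlim_compose[OF pow])
         (rule filterlim_compose[OF filterlim_nat_sequentially filterlim_floor_sequentially])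
    moreover have "\<forall>\<^sub>F t in at_top. norm (pmf (P t x) y - pmf p y) \<le> \<rho> ^ nat \<lfloor>t\<rfloor> * C x"
      using eventually_ge_at_top[of 0] by eventually_elim (simp add: bound)
    ultimately have "((\<lambda>t. pmf (P t x) y - pmf p y) \<longlongrightarrow> 0) at_top"
      by (rule Lim_null_comparison[rotated])
    then show ?thesis by (simp add: LIM_zero_iff)
  qed
  have shift: "filterlim (\<lambda>n. real n + t) at_top sequentially" for t
    using filterlim_tendsto_add_at_top[OF tendsto_const filterlim_real_sequentially, of t]
    by (simp add: add.commute)
  \<comment> \<open>Fatou yields \<open>p P\<^sub>t \<le> p\<close> pointwise, and two probability mass functions that are
    ordered pointwise agree.\<close>
  have inv: "bind_pmf p (P t) = p" if "0 \<le> t" for t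
  proof (rule ccontr)
    assume "bind_pmf p (P t) \<noteq> p"
    then obtain y where y: "pmf p y < pmf (bind_pmf p (P t)) y"
      using pmf_neq_exists_less by metis
    have "((\<lambda>n. pmf (P (real n + t) z) y) \<longlongrightarrow> pmf p y) sequentially"
      by (rule filterlim_compose[OF lim])
         (rule shift)
    then have "(\<lambda>n. ennreal (pmf (bind_pmf (P (real n) z) (P t)) y)) \<longlonglongrightarrow> ennreal (pmf p y)"
      using that by (simp add: add)
    then have "liminf (\<lambda>n. ennreal (pmf (bind_pmf (P (real n) z) (P t)) y)) = ennreal (pmf p y)"
      by (intro lim_imp_Liminf) auto
    moreover have "ennreal (pmf (bind_pmf p (P t)) y) \<le> liminf (\<lambda>n. ennreal (pmf (bind_pmf (P (real n) z) (P t)) y))"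
      unfolding ennreal_pmf_bind by (rule nn_integral_pmf_limit_le[OF seq])
    ultimately show False using y by (simp add: ennreal_le_iff)
  qed
  have "(\<integral>\<^sup>+y. ennreal (W y) \<partial>p) \<le> liminf (\<lambda>n. \<integral>\<^sup>+y. ennreal (W y) \<partial>P (real n) z)"
    by (rule nn_integral_pmf_limit_le[OF seq])
  also have "\<dots> \<le> liminf (\<lambda>n::nat. ennreal (W z + c))"
    by (intro Liminf_mono always_eventually allI tight)
  also have "\<dots> < \<infinity>" by (simp add: Liminf_const)
  finally show ?thesis using that inv lim by blast
qed

section \<open>The modulated queue\<close>

text \<open>Policy and score law are condensed into a state-dependent arrival rate \<open>a\<close>.
  At \<open>q = 0\<close> the factor \<open>min q m\<close> vanishes, so the truncated
  \<open>q - 1\<close> is harmless.\<close>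

definition queue_generator ::
    "(nat \<Rightarrow> 'r \<Rightarrow> real) \<Rightarrow> ('r \<Rightarrow> 'r \<Rightarrow> real) \<Rightarrow> nat \<Rightarrow> real \<Rightarrow> nat \<times> 'r \<Rightarrow> nat \<times> 'r \<Rightarrow> real" where
  "queue_generator a Q m \<mu> = (\<lambda>(q, \<theta>) y.
     a q \<theta> * (of_bool ((Suc q, \<theta>) = y) - of_bool ((q, \<theta>) = y)) +
     real (min q m) * \<mu> * (of_bool ((q - 1, \<theta>) = y) - of_bool ((q, \<theta>) = y)) +
     (if fst y = q then Q \<theta> (snd y) else 0))"

definition queue_nbrs :: "nat \<times> 'r \<Rightarrow> (nat \<times> 'r) set" where
  "queue_nbrs = (\<lambda>(q, \<theta>). {(Suc q, \<theta>), (q - 1, \<theta>)} \<union> {q} \<times> UNIV)"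

lemma sum_queue_generator:
  fixes Q :: "'r::finite \<Rightarrow> 'r \<Rightarrow> real"
  shows "(\<Sum>y\<in>queue_nbrs (q, \<theta>). queue_generator a Q m \<mu> (q, \<theta>) y * f y) =
    a q \<theta> * (f (Suc q, \<theta>) - f (q, \<theta>)) + real (min q m) * \<mu> * (f (q - 1, \<theta>) - f (q, \<theta>))
    + (\<Sum>j\<in>UNIV. Q \<theta> j * f (q, j))"
proof -
  let ?N = "queue_nbrs (q, \<theta>)"
  have fin: "finite ?N" by (simp add: queue_nbrs_def)
  have delta: "(\<Sum>y\<in>?N. of_bool (p = y) * f y) = f p" if "p \<in> ?N" for p
    using fin that by (simp add: of_bool_def if_distrib[of "\<lambda>x. x * _"] cong: if_cong)
  have nb: "(Suc q, \<theta>) \<in> ?N" "(q - 1, \<theta>) \<in> ?N" "(q, \<theta>) \<in> ?N"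
    by (auto simp: queue_nbrs_def)
  have "(\<Sum>y\<in>?N. (if fst y = q then Q \<theta> (snd y) else 0) * f y)
      = (\<Sum>y\<in>{q} \<times> UNIV. Q \<theta> (snd y) * f y)"
    using fin by (intro sum.mono_neutral_cong_right) (auto simp: queue_nbrs_def)
  also have "\<dots> = (\<Sum>j\<in>UNIV. Q \<theta> j * f (q, j))"
  proof -
    have eq: "{q} \<times> UNIV = Pair q ` UNIV" by auto
    show ?thesis unfolding eq by (subst sum.reindex) (auto simp: inj_on_def)
  qed
  finally have regime: "(\<Sum>y\<in>?N. (if fst y = q then Q \<theta> (snd y) else 0) * f y) = (\<Sum>j\<in>UNIV. Q \<theta> j * f (q, j))" .
  have "(\<Sum>y\<in>?N. queue_generator a Q m \<mu> (q, \<theta>) y * f y)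
      = (\<Sum>y\<in>?N. a q \<theta> * (of_bool ((Suc q, \<theta>) = y) * f y - of_bool ((q, \<theta>) = y) * f y)
        + real (min q m) * \<mu> * (of_bool ((q - 1, \<theta>) = y) * f y - of_bool ((q, \<theta>) = y) * f y)
        + (if fst y = q then Q \<theta> (snd y) else 0) * f y)"
    unfolding queue_generator_def split_conv by (intro sum.cong refl) (simp only: distrib_right left_diff_distrib right_diff_distrib mult.assoc)
  also have "\<dots> = a q \<theta> * (f (Suc q, \<theta>) - f (q, \<theta>))
      + real (min q m) * \<mu> * (f (q - 1, \<theta>) - f (q, \<theta>)) + (\<Sum>j\<in>UNIV. Q \<theta> j * f (q, j))"
    unfolding sum.distrib sum_distrib_left[symmetric] sum_subtractf delta[OF nb(1)] delta[OF nb(2)]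
      delta[OF nb(3)] regime ..
  finally show ?thesis .
qed

locale modulated_queue =
  fixes a :: "nat \<Rightarrow> 'r::finite \<Rightarrow> real" and Q :: "'r \<Rightarrow> 'r \<Rightarrow> real" and m :: nat and \<mu> A :: real
  assumes arrival_nonneg: "0 \<le> a q \<theta>" and arrival_le: "a q \<theta> \<le> A"
    and irreducible: "irreducible_generator Q" and service_pos: "0 < \<mu>" and server: "1 \<le> m"
begin

lemma regime_row: "(\<Sum>j\<in>UNIV. Q i j) = 0"
  and regime_off_diag: "i \<noteq> j \<Longrightarrow> 0 \<le> Q i j"
  and regime_connected: "(i, j) \<in> {(a, b). a \<noteq> b \<and> 0 < Q a b}\<^sup>*"
  using irreducible unfolding irreducible_generator_def by blast+

text \<open>The sum dominates every diagonal entry of \<open>Q\<close>, and the final 1 makes the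
  bound strict.\<close>

definition rate_bound :: real where
  "rate_bound = A + real m * \<mu> + (\<Sum>i\<in>UNIV. \<bar>Q i i\<bar>) + 1"

sublocale bounded_generator "queue_generator a Q m \<mu>" queue_nbrs rate_bound
proof
  fix x y :: "nat \<times> 'r"
  obtain q \<theta> where x: "x = (q, \<theta>)" by (cases x)
  show "finite (queue_nbrs x)" "x \<in> queue_nbrs x" by (auto simp: x queue_nbrs_def)
  show "queue_generator a Q m \<mu> x y = 0" if "y \<notin> queue_nbrs x"
    using that by (cases y) (auto simp: x queue_nbrs_def queue_generator_def)
  show "0 \<le> queue_generator a Q m \<mu> x y" if "x \<noteq> y"
    using that arrival_nonneg[of q \<theta>] service_pos regime_off_diag[of \<theta> "snd y"]
    by (cases y) (auto simp: x queue_generator_def)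
  show "(\<Sum>y\<in>queue_nbrs x. queue_generator a Q m \<mu> x y) = 0"
    using sum_queue_generator[where f = "\<lambda>_. 1" and Q = Q and a = a and m = m and \<mu> = \<mu> and q = q and \<theta> = \<theta>]
    by (simp add: x regime_row)
  show "- queue_generator a Q m \<mu> x x < rate_bound"
  proof -
    have "real (min q m) * \<mu> \<le> real m * \<mu>" using service_pos by (intro mult_right_mono) auto
    moreover have "\<bar>Q \<theta> \<theta>\<bar> \<le> (\<Sum>i\<in>UNIV. \<bar>Q i i\<bar>)" by (rule member_le_sum) auto
    moreover have "- queue_generator a Q m \<mu> x x
        \<le> a q \<theta> + real (min q m) * \<mu> + \<bar>Q \<theta> \<theta>\<bar>"
      using arrival_nonneg[of q \<theta>] service_pos by (cases q) (auto simp: x queue_generator_def)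
    ultimately show ?thesis using arrival_le[of q \<theta>] by (simp add: rate_bound_def)
  qed
qed

lemma gen_exp:
  "gen (\<lambda>(q, i). exp (\<eta> * (real q + h i))) (q, \<theta>) = exp (\<eta> * (real q + h \<theta>)) *
     (a q \<theta> * (exp \<eta> - 1) + real (min q m) * \<mu> * (exp (- \<eta>) - 1)
      + (\<Sum>j\<in>UNIV. Q \<theta> j * exp (\<eta> * (h j - h \<theta>))))"
proof -
  let ?E = "exp (\<eta> * (real q + h \<theta>))"
  have up: "exp (\<eta> * (real (Suc q) + h \<theta>)) = ?E * exp \<eta>"
    by (simp add: exp_add[symmetric] algebra_simps)
  have down: "real (min q m) * \<mu> * (exp (\<eta> * (real (q - 1) + h \<theta>)) - ?E)
      = real (min q m) * \<mu> * (?E * exp (- \<eta>) - ?E)"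
    by (cases q) (simp_all add: exp_add[symmetric] exp_diff[symmetric] algebra_simps)
  have regime: "exp (\<eta> * (real q + h j)) = ?E * exp (\<eta> * (h j - h \<theta>))" for j
    by (simp add: exp_add[symmetric] algebra_simps)
  have "gen (\<lambda>(q, i). exp (\<eta> * (real q + h i))) (q, \<theta>) = a q \<theta> * (?E * exp \<eta> - ?E)
      + real (min q m) * \<mu> * (?E * exp (- \<eta>) - ?E)
      + (\<Sum>j\<in>UNIV. Q \<theta> j * (?E * exp (\<eta> * (h j - h \<theta>))))"
    unfolding gen_def sum_queue_generator split_conv up down regime[symmetric] ..
  moreover have "(\<Sum>j\<in>UNIV. Q \<theta> j * (?E * exp (\<eta> * (h j - h \<theta>))))
      = ?E * (\<Sum>j\<in>UNIV. Q \<theta> j * exp (\<eta> * (h j - h \<theta>)))"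
    by (simp only: sum_distrib_left mult.left_commute)
  moreover have "A * (E * v - E) + B * (E * w - E) + E * S = E * (A * (v - 1) + B * (w - 1) + S)"
    for A B E v w S :: real by (simp add: algebra_simps)
  ultimately show ?thesis by (simp only:)
qed

text \<open>Services drain the queue within the current regime, then the regime moves along at level
  0. This supplies a common atom for Harris' theorem, whatever the arrival rates.\<close>

lemma reaches_empty: "(x, (0, j)) \<in> {(x, y). 0 < queue_generator a Q m \<mu> x y}\<^sup>*"
proof -
  let ?S = "{(x, y). 0 < queue_generator a Q m \<mu> x y}"
  obtain q i where x: "x = (q, i)" by (cases x)
  have "((q, i), (0, i)) \<in> ?S\<^sup>*"
  proof (induction q)
    case (Suc q)
    have "((Suc q, i), (q, i)) \<in> ?S"
      using service_pos server by (simp add: queue_generator_def)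
    then show ?case using Suc by (rule converse_rtrancl_into_rtrancl)
  qed simp
  also have "((0, i), (0, j)) \<in> ?S\<^sup>*"
    using regime_connected[of i j]
  proof (induction rule: rtrancl_induct)
    case (step b c)
    then have "((0, b), (0, c)) \<in> ?S" by (auto simp: queue_generator_def)
    with step.IH show ?case by (rule rtrancl_into_rtrancl)
  qed simp
  finally show ?thesis by (simp add: x)
qed

lemma steady_state_exists:
  assumes arrival: "\<And>q \<theta>. a q \<theta> = r \<theta>" and "stationary_distribution Q \<pi>"
    and load: "(\<Sum>\<theta>\<in>UNIV. \<pi> \<theta> * r \<theta>) < real m * \<mu>"
  shows "\<exists>p. steady_state (queue_generator a Q m \<mu>) p \<and>
    (\<integral>\<^sup>+x. ennreal (real (fst x)) \<partial>measure_pmf p) < \<infinity>"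
proof -
  obtain h where h: "\<And>i. 0 \<le> h i"
      "\<And>i. (\<Sum>j\<in>UNIV. Q i j * h j) = (\<Sum>k\<in>UNIV. \<pi> k * r k) - r i"
    by (rule poisson_equation_solvable[OF irreducible assms(2), where a = r]) (rule that)
  have sign: "1 * ((\<Sum>k\<in>UNIV. \<pi> k * r k) - real m * \<mu>) < 0" using load by simp
  obtain \<eta> k where \<eta>: "0 < \<eta>" and k: "0 < k" and
    tilt: "\<And>i. tilted_drift Q r (real m * \<mu>) h (1 * \<eta>) i \<le> - k"
    by (rule tilted_drift_neg[OF regime_row h(2) sign]) (rule that)
  define W where "W = (\<lambda>(q, i). exp (\<eta> * (real q + h i)))"
  have W: "0 \<le> W x" for x by (auto simp: W_def split: prod.split)
  have W_ge: "\<eta> * real (fst x) \<le> W x" for x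
  proof (cases x)
    case (Pair q i)
    have "\<eta> * real q \<le> \<eta> * (real q + h i)" using \<eta> h by simp
    also have "\<dots> \<le> exp (\<eta> * (real q + h i))"
      using exp_ge_add_one_self[of "\<eta> * (real q + h i)"] by linarith
    finally show ?thesis by (simp add: Pair W_def)
  qed
  \<comment> \<open>With \<open>q < m\<close> some servers idle and the tilted drift does not apply;
    these finitely many states are covered by the additive constant.\<close>
  define b where "b = Max (insert 0 ((\<lambda>x. gen W x + k * W x) ` ({..<m} \<times> UNIV)))"
  have drift: "gen W x \<le> - k * W x + b" for x
  proof (cases x)
    case (Pair q i)
    show ?thesis
    proof (cases "q < m")
      case True
      then have "gen W x + k * W x \<le> b" unfolding b_def Pair by (intro Max_ge) auto
      then show ?thesis by simp
    next
      case False
      then have "gen W x = W x * tilted_drift Q r (real m * \<mu>) h \<eta> i"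
        unfolding Pair W_def gen_exp by (simp add: tilted_drift_def arrival min_absorb2)
      also have "\<dots> \<le> W x * (- k)" using tilt[of i] W by (intro mult_left_mono) auto
      moreover have "0 \<le> b" by (simp add: b_def)
      ultimately show ?thesis by (simp add: mult.commute)
    qed
  qed
  \<comment> \<open>Uniformization needs a decay rate of at most \<open>rate_bound\<close>.\<close>
  define k' where "k' = min k rate_bound"
  have k': "0 < k'" "k' \<le> rate_bound" using k rate_bound_pos by (auto simp: k'_def)
  have drift': "gen W x \<le> - k' * W x + b" for x
  proof -
    have "k' * W x \<le> k * W x" using W by (intro mult_right_mono) (auto simp: k'_def)
    with drift[of x] show ?thesis by simp
  qed
  have b: "0 \<le> b" by (simp add: b_def)
  let ?P = "poissonized rate_bound uniformized"
  have semi: "transition_semigroup (queue_generator a Q m \<mu>) ?P"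
    by (rule transition_semigroup_poissonized)
  have small: "finite {x. W x \<le> R}" for R
  proof (rule finite_subset)
    show "{x. W x \<le> R} \<subseteq> {..nat \<lceil>R / \<eta>\<rceil>} \<times> UNIV"
    proof
      fix x assume "x \<in> {x. W x \<le> R}"
      then have "\<eta> * real (fst x) \<le> R" using W_ge[of x] by simp
      then have "real (fst x) \<le> R / \<eta>" using \<eta> by (simp add: field_simps)
      then have "fst x \<le> nat \<lceil>R / \<eta>\<rceil>" by linarith
      then show "x \<in> {..nat \<lceil>R / \<eta>\<rceil>} \<times> UNIV" by (cases x) auto
    qed
  qed simp
  obtain p where p: "\<And>t. 0 \<le> t \<Longrightarrow> bind_pmf p (?P t) = p"
    "\<And>x y. ((\<lambda>t. pmf (?P t x) y) \<longlongrightarrow> pmf p y) at_top"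
    "(\<integral>\<^sup>+y. ennreal (W y) \<partial>measure_pmf p) < \<infinity>"
  \<comment> \<open>The atom is the empty queue in an arbitrary fixed regime.\<close>
  proof (rule harris_ergodic[of ?P W k' "b / k'" "(0, undefined)"])
    show "?P (s + t) x = bind_pmf (?P s x) (?P t)" if "0 \<le> s" "0 \<le> t" for s t x
      using semi that unfolding transition_semigroup_def by blast
    show "(\<integral>\<^sup>+y. ennreal (W y) \<partial>measure_pmf (?P t x)) \<le> ennreal (exp (- k' * t) * W x + b / k')"
      if "0 \<le> t" for t x
      using poissonized_uniformized_drift[OF drift' W k' b that] .
    show "(0, undefined) \<in> set_pmf (?P 1 x)" for x
      using reachable_poissonized[OF reaches_empty] by simp
  qed (use k' b W small in auto)
  have "(\<integral>\<^sup>+x. ennreal (real (fst x)) \<partial>measure_pmf p) \<le> (\<integral>\<^sup>+x. ennreal (1 / \<eta>) * ennreal (W x) \<partial>measure_pmf p)"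
    using W_ge W \<eta> by (intro nn_integral_mono) (auto simp: ennreal_mult[symmetric] field_simps intro!: ennreal_leI)
  also have "\<dots> = ennreal (1 / \<eta>) * (\<integral>\<^sup>+x. ennreal (W x) \<partial>measure_pmf p)"
    by (rule nn_integral_cmult) simp
  also have "\<dots> < \<infinity>" using p(3) by (simp add: ennreal_mult_less_top)
  finally have "(\<integral>\<^sup>+x. ennreal (real (fst x)) \<partial>measure_pmf p) < \<infinity>" .
  moreover have "steady_state (queue_generator a Q m \<mu>) p"
    unfolding steady_state_def using semi p by blast
  ultimately show ?thesis by blast
qed

text \<open>The mass at \<open>y\<close> is at most the expectation of \<open>W\<close> divided by
  \<open>W y\<close>. As \<open>W \<le> 1\<close> at the start, the bound is uniform in the initial
  state, and it covers every semigroup with this generator.\<close>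

lemma overload_state_prob:
  assumes arrival: "\<And>q \<theta>. r \<theta> \<le> a q \<theta>" and "stationary_distribution Q \<pi>"
    and load: "real m * \<mu> < (\<Sum>\<theta>\<in>UNIV. \<pi> \<theta> * r \<theta>)"
  obtains k C where "0 < k"
    "\<And>P t x y. transition_semigroup (queue_generator a Q m \<mu>) P \<Longrightarrow> 0 \<le> t \<Longrightarrow>
       pmf (P t x) y \<le> C y * exp (- k * t)"
proof -
  obtain h where h: "\<And>i. 0 \<le> h i"
      "\<And>i. (\<Sum>j\<in>UNIV. Q i j * h j) = (\<Sum>k\<in>UNIV. \<pi> k * r k) - r i"
    by (rule poisson_equation_solvable[OF irreducible assms(2), where a = r]) (rule that)
  have sign: "- 1 * ((\<Sum>k\<in>UNIV. \<pi> k * r k) - real m * \<mu>) < 0" using load by simp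
  obtain \<eta> k where \<eta>: "0 < \<eta>" and k: "0 < k" and
    tilt: "\<And>i. tilted_drift Q r (real m * \<mu>) h (- 1 * \<eta>) i \<le> - k"
    by (rule tilted_drift_neg[OF regime_row h(2) sign]) (rule that)
  define W where "W = (\<lambda>(q, i). exp (- \<eta> * (real q + h i)))"
  have W: "0 < W x" "W x \<le> 1" for x
    using \<eta> h by (auto simp: W_def split: prod.split intro!: mult_nonneg_nonneg)
  have drift: "gen W x \<le> - k * W x" for x
  proof (cases x)
    case (Pair q i)
    \<comment> \<open>With negative tilt, extra arrivals and idle servers both lower the drift, so
      the bound holds for all \<open>q\<close> and no additive constant appears.\<close>
    have "a q i * (exp (- \<eta>) - 1) \<le> r i * (exp (- \<eta>) - 1)"
      using arrival[of i q] \<eta> by (intro mult_right_mono_neg) auto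
    moreover have "real (min q m) * \<mu> * (exp \<eta> - 1) \<le> real m * \<mu> * (exp \<eta> - 1)"
      using service_pos \<eta> by (intro mult_right_mono) auto
    ultimately have "gen W x \<le> W x * tilted_drift Q r (real m * \<mu>) h (- \<eta>) i"
      unfolding Pair W_def gen_exp split_conv tilted_drift_def
      by (intro mult_left_mono add_mono) auto
    also have "\<dots> \<le> W x * (- k)" using tilt[of i] W(1)[of x] by (intro mult_left_mono) auto
    finally show ?thesis by (simp add: mult.commute)
  qed
  show ?thesis
  proof (rule that[OF k])
    fix P t x y
    assume P: "transition_semigroup (queue_generator a Q m \<mu>) P" and t: "0 \<le> (t::real)"
    have "W y * pmf (P t x) y = measure_pmf.expectation (P t x) (\<lambda>z. W y * indicator {y} z)"
      by (simp add: measure_pmf_single)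
    also have "\<dots> \<le> measure_pmf.expectation (P t x) W"
      using W by (intro integral_mono measure_pmf.integrable_const_bound[where B = 1])
        (auto simp: indicator_def less_imp_le)
    also have "\<dots> \<le> exp (- k * t) * W x"
      using W by (intro expectation_exp_decay[OF P _ _ drift t]) (auto simp: less_imp_le)
    also have "\<dots> \<le> exp (- k * t)" using W(2)[of x] by simp
    finally show "pmf (P t x) y \<le> (1 / W y) * exp (- k * t)"
      using W(1)[of y] by (simp add: field_simps)
  qed
qed

end

text \<open>Conditioning on the countably many values of \<open>X 0\<close>: a bound uniform in the
  starting state holds for any initial law.\<close>

lemma ctmc_state_prob_le:
  fixes X :: "real \<Rightarrow> 'w \<Rightarrow> 'a::countable"
  assumes "prob_space M" and meas: "\<And>t. 0 \<le> t \<Longrightarrow> X t \<in> measurable M (count_space UNIV)"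
    and two: "\<And>x. measure M {\<omega> \<in> space M. X 0 \<omega> = x \<and> X t \<omega> = y}
        = measure M {\<omega> \<in> space M. X 0 \<omega> = x} * pmf (P x) y"
    and le: "\<And>x. pmf (P x) y \<le> c" and "0 \<le> t"
  shows "measure M {\<omega> \<in> space M. X t \<omega> = y} \<le> c"
proof -
  interpret prob_space M by fact
  have [measurable]: "X 0 \<in> measurable M (count_space UNIV)" "X t \<in> measurable M (count_space UNIV)"
    using meas \<open>0 \<le> t\<close> by auto
  have c: "0 \<le> c" using le pmf_nonneg order_trans by metis
  have "emeasure M {\<omega> \<in> space M. X t \<omega> = y}
      = emeasure M (\<Union>x. {\<omega> \<in> space M. X 0 \<omega> = x \<and> X t \<omega> = y})"
    by (rule arg_cong[where f = "emeasure M"]) auto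
  also have "\<dots> = (\<integral>\<^sup>+x. emeasure M {\<omega> \<in> space M. X 0 \<omega> = x \<and> X t \<omega> = y} \<partial>count_space UNIV)"
    by (rule emeasure_UN_countable) (auto simp: disjoint_family_on_def)
  also have "\<dots> \<le> (\<integral>\<^sup>+x. ennreal c * emeasure M {\<omega> \<in> space M. X 0 \<omega> = x} \<partial>count_space UNIV)"
    using le c unfolding emeasure_eq_measure two
    by (intro nn_integral_mono) (auto simp: ennreal_mult[symmetric] mult.commute[of c] intro!: ennreal_leI mult_left_mono)
  also have "\<dots> = ennreal c * (\<integral>\<^sup>+x. emeasure M {\<omega> \<in> space M. X 0 \<omega> = x} \<partial>count_space UNIV)"
    by (rule nn_integral_cmult) simp
  also have "(\<integral>\<^sup>+x. emeasure M {\<omega> \<in> space M. X 0 \<omega> = x} \<partial>count_space UNIV)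
      = emeasure M (\<Union>x. {\<omega> \<in> space M. X 0 \<omega> = x})"
    by (rule emeasure_UN_countable[symmetric]) (auto simp: disjoint_family_on_def)
  also have "\<dots> = 1"
  proof -
    have "(\<Union>x. {\<omega> \<in> space M. X 0 \<omega> = x}) = space M" by auto
    then show ?thesis by (simp add: emeasure_space_1)
  qed
  finally show ?thesis using c by (simp add: emeasure_eq_measure)
qed

lemma (in modulated_queue) overload_unstable:
  assumes arrival: "\<And>q \<theta>. r \<theta> \<le> a q \<theta>" and stat: "stationary_distribution Q \<pi>"
    and load: "real m * \<mu> < (\<Sum>\<theta>\<in>UNIV. \<pi> \<theta> * r \<theta>)"
    and ctmc: "ctmc M X (queue_generator a Q m \<mu>)"
  shows "unstable M X"
proof -
  obtain k C where k: "0 < k" and decay: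
    "\<And>P t x y. transition_semigroup (queue_generator a Q m \<mu>) P \<Longrightarrow> 0 \<le> t \<Longrightarrow>
       pmf (P t x) y \<le> C y * exp (- k * t)"
    using overload_state_prob[OF arrival stat load] by blast
  obtain P where "prob_space M" and meas: "\<And>t. 0 \<le> t \<Longrightarrow> X t \<in> measurable M (count_space UNIV)"
    and P: "transition_semigroup (queue_generator a Q m \<mu>) P"
    and fdd: "\<And>n (\<tau> :: nat \<Rightarrow> real) x. 0 \<le> \<tau> 0 \<and> (\<forall>i<n. \<tau> i \<le> \<tau> (Suc i)) \<Longrightarrow>
           measure M {\<omega> \<in> space M. \<forall>i\<le>n. X (\<tau> i) \<omega> = x i} =
           measure M {\<omega> \<in> space M. X (\<tau> 0) \<omega> = x 0} *
             (\<Prod>i<n. pmf (P (\<tau> (Suc i) - \<tau> i) (x i)) (x (Suc i)))"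
    using ctmc unfolding ctmc_def by blast
  interpret prob_space M by fact
  have state: "measure M {\<omega> \<in> space M. X t \<omega> = y} \<le> C y * exp (- k * t)" if "0 \<le> t" for t y
  proof (rule ctmc_state_prob_le[OF \<open>prob_space M\<close> meas _ decay[OF P that] that])
    fix x
    \<comment> \<open>With \<open>n = 1\<close> and the times 0 and \<open>t\<close>, the
      finite-dimensional formula becomes the joint law of \<open>X 0\<close> and
      \<open>X t\<close>.\<close>
    have all1: "(\<forall>i\<le>(1::nat). R i) \<longleftrightarrow> R 0 \<and> R 1" for R
      by (metis le_0_eq le_Suc_eq One_nat_def)
    show "measure M {\<omega> \<in> space M. X 0 \<omega> = x \<and> X t \<omega> = y}
        = measure M {\<omega> \<in> space M. X 0 \<omega> = x} * pmf (P t x) y"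
      using fdd[of "\<lambda>i. if i = 0 then 0 else t" 1 "\<lambda>i. if i = 0 then x else y"] that
      unfolding all1 by simp
  qed
  show ?thesis
    unfolding unstable_def
  proof
    fix N :: nat
    \<comment> \<open>Only finitely many states have queue length at most \<open>N\<close>, and each
      of them loses its mass.\<close>
    let ?F = "{..N} \<times> (UNIV :: 'r set)"
    have eq: "measure M {\<omega> \<in> space M. N < fst (X t \<omega>)}
        = 1 - (\<Sum>y\<in>?F. measure M {\<omega> \<in> space M. X t \<omega> = y})" if "0 \<le> t" for t
    proof -
      have [measurable]: "X t \<in> measurable M (count_space UNIV)" by (rule meas[OF that])
      have "(\<Sum>y\<in>?F. measure M {\<omega> \<in> space M. X t \<omega> = y})
          = measure M (\<Union>y\<in>?F. {\<omega> \<in> space M. X t \<omega> = y})"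
        by (rule finite_measure_finite_Union[symmetric]) (auto simp: disjoint_family_on_def)
      also have "(\<Union>y\<in>?F. {\<omega> \<in> space M. X t \<omega> = y}) = space M - {\<omega> \<in> space M. N < fst (X t \<omega>)}"
        by (auto simp: not_less mem_Times_iff)
      also have "measure M \<dots> = 1 - measure M {\<omega> \<in> space M. N < fst (X t \<omega>)}"
        by (rule prob_compl) measurable
      finally show ?thesis by simp
    qed
    have exp0: "((\<lambda>t. exp (- k * t)) \<longlongrightarrow> 0) at_top"
    proof (rule filterlim_compose[OF exp_at_bot])
      show "filterlim (\<lambda>t. - k * t) at_bot at_top"
        using filterlim_tendsto_neg_mult_at_bot[OF tendsto_const[of "- k"] _ filterlim_ident] k by simp
    qed
    have "((\<lambda>t. measure M {\<omega> \<in> space M. X t \<omega> = y}) \<longlongrightarrow> 0) at_top" for y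
    proof (rule Lim_null_comparison)
      show "\<forall>\<^sub>F t in at_top. norm (measure M {\<omega> \<in> space M. X t \<omega> = y}) \<le> C y * exp (- k * t)"
        using eventually_ge_at_top[of 0] by eventually_elim (simp add: state[simplified])
      show "((\<lambda>t. C y * exp (- k * t)) \<longlongrightarrow> 0) at_top"
        by (rule tendsto_mult_right_zero[OF exp0])
    qed
    then have "((\<lambda>t. 1 - (\<Sum>y\<in>?F. measure M {\<omega> \<in> space M. X t \<omega> = y})) \<longlongrightarrow> 1 - (\<Sum>y\<in>?F. 0)) at_top"
      by (intro tendsto_intros)
    then have "((\<lambda>t. 1 - (\<Sum>y\<in>?F. measure M {\<omega> \<in> space M. X t \<omega> = y})) \<longlongrightarrow> 1) at_top" by simp
    then show "((\<lambda>t. measure M {\<omega> \<in> space M. N < fst (X t \<omega>)}) \<longlongrightarrow> 1) at_top"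
      by (rule Lim_transform_eventually)
         (use eventually_ge_at_top[of 0] in \<open>eventually_elim, simp add: eq\<close>)
  qed
qed

section \<open>Scores and policies\<close>

lemma score_law_sets: "score_law D \<Longrightarrow> sets D = sets borel"
  and score_law_space: "score_law D \<Longrightarrow> space D = UNIV"
  by (auto simp: score_law_def)

text \<open>Continuity holds on the open interval only, so the two end points are split off as
  single values.\<close>

lemma score_law_density_measurable:
  fixes f :: "real \<Rightarrow> real"
  assumes "continuous_on {0<..<1} f"
  shows "(\<lambda>s. ennreal (f s) * indicator {0..1} s) \<in> borel_measurable borel"
proof -
  have [measurable]: "(\<lambda>s. indicator {0<..<1} s *\<^sub>R f s) \<in> borel_measurable borel"
    using assms by (intro borel_measurable_continuous_on_indicator) auto
  have "(\<lambda>s. ennreal (f s) * indicator {0..1} s) = (\<lambda>s. if s = 0 then ennreal (f 0) else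
      if s = 1 then ennreal (f 1) else ennreal (indicator {0<..<1} s *\<^sub>R f s))"
    by (auto simp: fun_eq_iff indicator_def)
  then show ?thesis by simp
qed

lemma score_law_supported:
  assumes "score_law D" and A: "A \<in> sets borel"
  shows "measure D A = measure D (A \<inter> {0..1})"
proof -
  obtain f where f: "continuous_on {0<..<1} f"
    and D: "D = density lborel (\<lambda>s. ennreal (f s) * indicator {0..1} s)"
    using assms(1) unfolding score_law_def by blast
  have "emeasure D A = emeasure D (A \<inter> {0..1})"
    unfolding D using A score_law_density_measurable[OF f]
    by (auto simp: emeasure_density indicator_def intro!: nn_integral_cong)
  then show ?thesis by (simp add: measure_def)
qed

lemma score_law_singleton:
  assumes "score_law D"
  shows "measure D {x} = 0"
proof -
  obtain f where f: "continuous_on {0<..<1} f"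
    and D: "D = density lborel (\<lambda>s. ennreal (f s) * indicator {0..1} s)"
    using assms unfolding score_law_def by blast
  have "emeasure D {x} = 0"
    unfolding D using score_law_density_measurable[OF f]
    by (subst emeasure_density) (auto intro!: nn_integral_null_set simp: null_sets_def)
  then show ?thesis by (simp add: measure_def)
qed

lemma markov_policy_section:
  assumes "markov_policy u"
  shows "u q \<theta> \<in> measurable (restrict_space borel {0..1}) (count_space {0, 1})"
proof -
  have "(\<lambda>s. ((q, \<theta>), s)) \<in> measurable (restrict_space borel {0..1})
      (count_space UNIV \<Otimes>\<^sub>M restrict_space borel {0..1})"
    by (intro measurable_Pair measurable_const) auto
  from measurable_compose[OF this assms[unfolded markov_policy_def]] show ?thesis by simp
qed

lemma markov_policy_values:
  assumes "markov_policy u" "s \<in> {0..1}"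
  shows "u q \<theta> s = 0 \<or> u q \<theta> s = 1"
  using measurable_space[OF markov_policy_section[OF assms(1)], of s q \<theta>] assms(2)
  by (auto simp: space_restrict_space)

lemma markov_policy_level_sets:
  assumes "markov_policy u"
  shows "{s \<in> {0..1}. u q \<theta> s = v} \<in> sets borel"
proof (cases "v \<in> {0, 1}")
  case True
  have "u q \<theta> -` {v} \<inter> space (restrict_space borel {0..1}) \<in> sets (restrict_space borel {0..1})"
    using True by (intro measurable_sets[OF markov_policy_section[OF assms]]) auto
  also have "u q \<theta> -` {v} \<inter> space (restrict_space borel {0..1}) = {s \<in> {0..1}. u q \<theta> s = v}"
    by (auto simp: space_restrict_space)
  finally show ?thesis by (simp add: sets_restrict_space_iff)
next
  case False
  then have "{s \<in> {0..1}. u q \<theta> s = v} = {}"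
    using markov_policy_values[OF assms, where q = q and \<theta> = \<theta>] by force
  then show ?thesis by (simp only: sets.empty_sets)
qed

lemma automate_prob:
  assumes "score_law D" "markov_policy u"
  shows "measure D {s \<in> {0..1}. u q \<theta> s = 0} = 1 - measure D {s \<in> {0..1}. u q \<theta> s = 1}"
proof -
  interpret prob_space D using assms(1) by (simp add: score_law_def)
  have sets: "{s \<in> {0..1}. u q \<theta> s = v} \<in> sets D" for v
    using markov_policy_level_sets[OF assms(2)] by (simp add: score_law_sets[OF assms(1)])
  have "measure D {s \<in> {0..1}. u q \<theta> s = 0} + measure D {s \<in> {0..1}. u q \<theta> s = 1}
      = measure D ({s \<in> {0..1}. u q \<theta> s = 0} \<union> {s \<in> {0..1}. u q \<theta> s = 1})"
    by (rule finite_measure_Union[OF sets sets, symmetric]) auto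
  also have "{s \<in> {0..1}. u q \<theta> s = 0} \<union> {s \<in> {0..1}. u q \<theta> s = 1} = UNIV \<inter> {0..1}"
    using markov_policy_values[OF assms(2), where q = q and \<theta> = \<theta>] by blast
  also have "measure D \<dots> = 1"
    using score_law_supported[OF assms(1), of UNIV] prob_space by (simp add: score_law_space[OF assms(1)])
  finally show ?thesis by simp
qed

text \<open>A fresh score is drawn at each arrival, so it acts only through its escalation
  probability; automated arrivals leave the state unchanged and cancel against the diagonal
  term.\<close>

lemma system_generator_eq_queue_generator:
  assumes "score_law D" "markov_policy u"
  shows "system_generator lam D Q m \<mu> u
    = queue_generator (\<lambda>q \<theta>. lam * measure D {s \<in> {0..1}. u q \<theta> s = 1}) Q m \<mu>"
proof (intro ext)
  fix x y :: "nat \<times> 'a"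
  obtain q \<theta> where x: "x = (q, \<theta>)" by (cases x)
  let ?e = "measure D {s \<in> {0..1}. u q \<theta> s = 1}"
  consider "y = (q, \<theta>)" | "y = (Suc q, \<theta>)" | "y \<noteq> (q, \<theta>)" "y \<noteq> (Suc q, \<theta>)" by blast
  then have "measure D {s \<in> {0..1}. (q + u q \<theta> s, \<theta>) = y} - of_bool ((q, \<theta>) = y)
      = ?e * (of_bool ((Suc q, \<theta>) = y) - of_bool ((q, \<theta>) = y))"
  proof cases
    case 1
    then show ?thesis using automate_prob[OF assms, of q \<theta>] by simp
  next
    case 2
    then show ?thesis by simp
  next
    case 3
    then have eq: "{s \<in> {0..1}. (q + u q \<theta> s, \<theta>) = y} = {}"
      using markov_policy_values[OF assms(2), where q = q and \<theta> = \<theta>] by force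
    show ?thesis unfolding eq using 3 by auto
  qed
  then show "system_generator lam D Q m \<mu> u x y
    = queue_generator (\<lambda>q \<theta>. lam * measure D {s \<in> {0..1}. u q \<theta> s = 1}) Q m \<mu> x y"
    by (simp add: x system_generator_def queue_generator_def)
qed

lemma modulated_queue_policy:
  assumes "0 < lam" "0 < \<mu>" "1 \<le> m" "score_law D" "irreducible_generator Q"
  shows "modulated_queue (\<lambda>q \<theta>. lam * measure D {s \<in> {0..1}. u q \<theta> s = 1}) Q m \<mu> lam"
proof -
  interpret prob_space D using assms(4) by (simp add: score_law_def)
  show ?thesis
    using assms by unfold_locales (auto simp: mult_left_le)
qed

section \<open>Threshold policies and the minimum arrival rate\<close>

definition threshold_policy :: "('r \<Rightarrow> real) \<Rightarrow> 'r policy" where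
  "threshold_policy T = (\<lambda>q \<theta> s. of_bool (T \<theta> \<le> s))"

text \<open>The pair of queue length and regime ranges over a countable set, so joint measurability
  follows from that of each slice in the score.\<close>

lemma markov_policy_threshold:
  fixes T :: "'r::finite \<Rightarrow> real"
  shows "markov_policy (threshold_policy T)"
proof -
  have eq: "(\<lambda>((q, \<theta>), s). threshold_policy T q \<theta> s)
      = (\<lambda>x. (\<lambda>(p::nat \<times> 'r) s. of_bool (T (snd p) \<le> s) :: nat) (fst x) (snd x))"
    by (auto simp: threshold_policy_def fun_eq_iff)
  have slice: "(\<lambda>s. of_bool (T \<theta> \<le> s) :: nat) \<in> measurable (restrict_space borel {0..1}) (count_space {0, 1})" for \<theta>
  proof (rule measurable_restrict_space1)
    have "{s. T \<theta> \<le> s} \<in> sets borel" by simp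
    then show "(\<lambda>s. of_bool (T \<theta> \<le> s) :: nat) \<in> measurable borel (count_space {0, 1})"
      by (intro measurable_count_space_eq2[THEN iffD2])
         (auto simp: vimage_def)
  qed
  show ?thesis
    unfolding markov_policy_def eq
    by (rule measurable_compose_countable[where f = "\<lambda>p x. of_bool (T (snd p) \<le> snd x)" and g = fst])
       (intro measurable_compose[OF measurable_snd slice] measurable_fst countableI_type)+
qed

text \<open>The closed form matches the threshold policy, the strict form the violation set; they
  agree because the score law has no atoms.\<close>

lemma min_rate_eq:
  assumes "score_law D"
  shows "min_rate lam D c \<epsilon> \<theta> = lam * measure D {s \<in> {0..1}. max_threshold D c \<epsilon> \<theta> \<le> s}"
    "min_rate lam D c \<epsilon> \<theta> = lam * measure D {s \<in> {0..1}. max_threshold D c \<epsilon> \<theta> < s}"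
proof -
  interpret prob_space D using assms by (simp add: score_law_def)
  let ?T = "max_threshold D c \<epsilon> \<theta>"
  have "measure D {s. ?T \<le> s} = measure D ({s. ?T \<le> s} \<inter> {0..1})"
    by (rule score_law_supported[OF assms]) simp
  also have "{s. ?T \<le> s} \<inter> {0..1} = {s \<in> {0..1}. ?T \<le> s}" by auto
  finally show "min_rate lam D c \<epsilon> \<theta> = lam * measure D {s \<in> {0..1}. ?T \<le> s}"
    by (simp add: min_rate_def)
  have "measure D {s. ?T \<le> s} = measure D ({s. ?T < s} \<union> {?T})"
    by (rule arg_cong[where f = "measure D"]) auto
  also have "\<dots> = measure D {s. ?T < s} + measure D {?T}"
    by (rule finite_measure_Union) (auto simp: score_law_sets[OF assms])
  also have "\<dots> = measure D {s. ?T < s}" by (simp add: score_law_singleton[OF assms])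
  also have "\<dots> = measure D ({s. ?T < s} \<inter> {0..1})"
    by (rule score_law_supported[OF assms]) simp
  also have "{s. ?T < s} \<inter> {0..1} = {s \<in> {0..1}. ?T < s}" by auto
  finally show "min_rate lam D c \<epsilon> \<theta> = lam * measure D {s \<in> {0..1}. ?T < s}"
    by (simp add: min_rate_def)
qed

text \<open>Each pair \<open>(q, \<theta>)\<close> has counting measure 1, so a null violation set
  has only null sections: in every state almost all scores above the threshold are
  escalated.\<close>

lemma escalation_rate_ge_min_rate:
  fixes u :: "'r::finite policy"
  assumes "0 < lam" "score_law D" "markov_policy u"
    and null: "emeasure (count_space UNIV \<Otimes>\<^sub>M D) (violation_set D c \<epsilon> u) = 0"
  shows "min_rate lam D c \<epsilon> \<theta> \<le> lam * measure D {s \<in> {0..1}. u q \<theta> s = 1}"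
proof -
  interpret prob_space D using assms(2) by (simp add: score_law_def)
  let ?V = "\<lambda>(q, \<theta>). {s \<in> {0..1}. max_threshold D c \<epsilon> \<theta> < s \<and> u q \<theta> s = 0}"
  have V: "?V p \<in> sets D" for p
  proof (cases p)
    case (Pair q \<theta>)
    have "?V p = {s \<in> {0..1}. u q \<theta> s = 0} \<inter> {max_threshold D c \<epsilon> \<theta> <..}"
      by (auto simp: Pair)
    then show ?thesis
      using markov_policy_level_sets[OF assms(3)] by (simp add: score_law_sets[OF assms(2)])
  qed
  have violation: "violation_set D c \<epsilon> u = (\<Union>p. {p} \<times> ?V p)"
    by (auto simp: violation_set_def)
  have "emeasure (count_space UNIV \<Otimes>\<^sub>M D) ({(q, \<theta>)} \<times> ?V (q, \<theta>))
      \<le> emeasure (count_space UNIV \<Otimes>\<^sub>M D) (violation_set D c \<epsilon> u)"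
  proof (rule emeasure_mono)
    show "violation_set D c \<epsilon> u \<in> sets (count_space UNIV \<Otimes>\<^sub>M D)"
      unfolding violation by (intro sets.countable_UN'' pair_measureI V) auto
  qed (unfold violation, blast)
  also have "emeasure (count_space UNIV \<Otimes>\<^sub>M D) ({(q, \<theta>)} \<times> ?V (q, \<theta>))
      = emeasure (count_space UNIV) {(q, \<theta>)} * emeasure D (?V (q, \<theta>))"
    by (rule emeasure_pair_measure_Times) (use V[of "(q, \<theta>)"] in auto)
  finally have "emeasure D (?V (q, \<theta>)) = 0" by (simp add: null)
  then have V0: "measure D (?V (q, \<theta>)) = 0" by (simp only: measure_def enn2real_0)
  have E: "{s \<in> {0..1}. u q \<theta> s = 1} \<in> sets D"
    using markov_policy_level_sets[OF assms(3)] by (simp only: score_law_sets[OF assms(2)])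
  have "measure D {s \<in> {0..1}. max_threshold D c \<epsilon> \<theta> < s}
      \<le> measure D ({s \<in> {0..1}. u q \<theta> s = 1} \<union> ?V (q, \<theta>))"
  proof (rule finite_measure_mono)
    show "{s \<in> {0..1}. max_threshold D c \<epsilon> \<theta> < s} \<subseteq> {s \<in> {0..1}. u q \<theta> s = 1} \<union> ?V (q, \<theta>)"
      using markov_policy_values[OF assms(3), where q = q and \<theta> = \<theta>] by blast
  qed (intro sets.Un E V)
  also have "\<dots> \<le> measure D {s \<in> {0..1}. u q \<theta> s = 1} + measure D (?V (q, \<theta>))"
    by (intro measure_Un_le E V)
  finally have "measure D {s \<in> {0..1}. max_threshold D c \<epsilon> \<theta> < s} \<le> measure D {s \<in> {0..1}. u q \<theta> s = 1}"
    by (simp only: V0 add_0_right)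
  then show ?thesis
    unfolding min_rate_eq(2)[OF assms(2)] using assms(1) by (intro mult_left_mono) auto
qed

theorem theorem4:
  fixes lam \<mu> \<epsilon> :: real and m :: nat
    and D :: "real measure"
    and Q :: "'r::{finite,linorder} \<Rightarrow> 'r \<Rightarrow> real" and \<pi> :: "'r \<Rightarrow> real"
    and c :: "real \<Rightarrow> 'r \<Rightarrow> real"
  assumes "0 < lam" and "0 < \<mu>" and "1 \<le> m" and "0 \<le> \<epsilon>"
    and "score_law D"
    and "irreducible_generator Q" and "stationary_distribution Q \<pi>"
    and "automation_cost c"
  shows
    "(required_capacity lam D c \<epsilon> \<pi> < real m * \<mu> \<longrightarrow>
       (\<exists>u. markov_policy u \<and> eps_safe D c \<epsilon> u \<and>
          (\<exists>p. steady_state (system_generator lam D Q m \<mu> u) p \<and>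
             (\<integral>\<^sup>+ x. ennreal (real (fst x)) \<partial>measure_pmf p) < \<infinity>))) \<and>
     (real m * \<mu> < required_capacity lam D c \<epsilon> \<pi> \<longrightarrow>
       (\<forall>u. markov_policy u \<longrightarrow>
          (\<forall>(M :: 'w measure) X. ctmc M X (system_generator lam D Q m \<mu> u) \<longrightarrow> unstable M X) \<or>
          0 < emeasure (count_space UNIV \<Otimes>\<^sub>M D) (violation_set D c \<epsilon> u)))"
proof (intro conjI impI allI)
  assume load: "required_capacity lam D c \<epsilon> \<pi> < real m * \<mu>"
  define u :: "'r policy" where "u = threshold_policy (max_threshold D c \<epsilon>)"
  have u: "markov_policy u" unfolding u_def by (rule markov_policy_threshold)
  have "eps_safe D c \<epsilon> u" by (auto simp: eps_safe_def u_def threshold_policy_def)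
  moreover have "\<exists>p. steady_state (system_generator lam D Q m \<mu> u) p \<and>
      (\<integral>\<^sup>+ x. ennreal (real (fst x)) \<partial>measure_pmf p) < \<infinity>"
    unfolding system_generator_eq_queue_generator[OF assms(5) u]
  proof (rule modulated_queue.steady_state_exists[OF modulated_queue_policy[OF assms(1-3,5,6)] _ assms(7)])
    \<comment> \<open>Escalating exactly from the threshold upwards attains the minimum rate in
      every state, which makes the load equal to the required capacity.\<close>
    show "lam * measure D {s \<in> {0..1}. u q \<theta> s = 1} = min_rate lam D c \<epsilon> \<theta>" for q \<theta>
    proof -
      have "{s \<in> {0..1}. u q \<theta> s = 1} = {s \<in> {0..1}. max_threshold D c \<epsilon> \<theta> \<le> s}"
        by (auto simp: u_def threshold_policy_def)
      then show ?thesis by (simp only: min_rate_eq(1)[OF assms(5)])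
    qed
    show "(\<Sum>\<theta>\<in>UNIV. \<pi> \<theta> * min_rate lam D c \<epsilon> \<theta>) < real m * \<mu>"
      using load by (simp add: required_capacity_def)
  qed
  ultimately show "\<exists>u. markov_policy u \<and> eps_safe D c \<epsilon> u \<and>
      (\<exists>p. steady_state (system_generator lam D Q m \<mu> u) p \<and>
        (\<integral>\<^sup>+ x. ennreal (real (fst x)) \<partial>measure_pmf p) < \<infinity>)"
    using u by blast
next
  fix u :: "'r policy"
  assume load: "real m * \<mu> < required_capacity lam D c \<epsilon> \<pi>" and u: "markov_policy u"
  show "(\<forall>(M :: 'w measure) X. ctmc M X (system_generator lam D Q m \<mu> u) \<longrightarrow> unstable M X) \<or>
      0 < emeasure (count_space UNIV \<Otimes>\<^sub>M D) (violation_set D c \<epsilon> u)"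
  proof (cases "emeasure (count_space UNIV \<Otimes>\<^sub>M D) (violation_set D c \<epsilon> u) = 0")
    case True
    have "unstable M X" if "ctmc M X (system_generator lam D Q m \<mu> u)" for M :: "'w measure" and X
    proof (rule modulated_queue.overload_unstable[OF modulated_queue_policy[OF assms(1-3,5,6)] _ assms(7)])
      show "min_rate lam D c \<epsilon> \<theta> \<le> lam * measure D {s \<in> {0..1}. u q \<theta> s = 1}" for q \<theta>
        by (rule escalation_rate_ge_min_rate[OF assms(1,5) u True])
      show "real m * \<mu> < (\<Sum>\<theta>\<in>UNIV. \<pi> \<theta> * min_rate lam D c \<epsilon> \<theta>)"
        using load by (simp add: required_capacity_def)
      show "ctmc M X (queue_generator (\<lambda>q \<theta>. lam * measure D {s \<in> {0..1}. u q \<theta> s = 1}) Q m \<mu>)"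
        using that by (simp add: system_generator_eq_queue_generator[OF assms(5) u])
    qed
    then show ?thesis by blast
  next
    case False
    then show ?thesis by (simp add: zero_less_iff_neq_zero)
  qed
qed

end
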